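(* Let $p\in(0,\infty)$. Then the following statements hold. (i) For any $d\in(-\infty,0)$, $\mathbb D_{p,\infty,d}^{\mathrm{upper}}=\emptyset$. (ii) $\bigcup_{d\in[0,\infty)}\mathbb D_{p,\infty,d}^{\mathrm{upper}}=A_{p,\infty}$. (iii) For any $d_1,d_2\in[0,\infty)$ with $d_1<d_2$, $\mathbb D_{p,\infty,d_1}^{\mathrm{upper}}\subsetneqq\mathbb D_{p,\infty,d_2}^{\mathrm{upper}}$. (iv) If $p\in(0,1]$, then $A_p\subset\mathbb D_{p,\infty,0}^{\mathrm{upper}}$.
   Context: Fix $m,n\in\mathbb N$. $M_m(\mathbb C)$ is the set of complex $m\times m$ matrices and $\|\cdot\|$ is the operator norm induced by the Euclidean norm of $\mathbb C^m$. A cube in $\mathbb R^n$ has edges parallel to the coordinate axes and finite positive edge length (not necessarily open or closed); $\lambda Q$ is the cube with the same center as $Q$ and edge length $\lambda$ times that of $Q$. $\fint_E f:=\frac1{|E|}\int_E f$, $\log_+t:=\max\{0,\log t\}$. A matrix weight is a function $W:\mathbb R^n\to M_m(\mathbb C)$ such that $W(x)$ is nonnegative definite for every $x$, $W(x)$ is invertible for almost every $x$, and all entries of $W$ are locally integrable. Real powers $W^\alpha(x)$ are defined by the spectral theorem. For $p\in(0,1]$, $A_p=A_p(\mathbb R^n,\mathbb C^m)$ is the class of matrix weights with $\sup_Q\operatorname*{ess\,sup}_{y\in Q}\fint_Q\|W^{1/p}(x)W^{-1/p}(y)\|^p\,dx<\infty$, the supremum being over all cubes $Q$. $A_{p,\infty}=A_{p,\infty}(\mathbb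 R^n,\mathbb C^m)$ is the class of matrix weights $W$ such that, for every cube $Q$, $\log_+\left(\fint_Q\|W^{1/p}(x)W^{-1/p}(\cdot)\|^p\,dx\right)\in L^1(Q)$, and $[W]_{A_{p,\infty}}:=\sup_Q\exp\left(\fint_Q\log\left(\fint_Q\|W^{1/p}(x)W^{-1/p}(y)\|^p\,dx\right)dy\right)<\infty$. For $d\in\mathbb R$, $\mathbb D_{p,\infty,d}^{\mathrm{upper}}=\mathbb D_{p,\infty,d}^{\mathrm{upper}}(\mathbb R^n,\mathbb C^m)$ is the class of matrix weights $W$ ("of $A_{p,\infty}$-upper dimension $d$") for which there is a constant $C>0$ such that, for any $\lambda\in[1,\infty)$ and any cube $Q\subset\mathbb R^n$, $$\exp\left(\fint_Q\log\left(\fint_{\lambda Q}\|W^{1/p}(x)W^{-1/p}(y)\|^p\,dx\right)dy\right)\le C\lambda^d.$$ *)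

theory Defs
  imports "HOL-Analysis.Analysis" "HOL-Probability.Essential_Supremum"
begin

section \<open>Matrices\<close>

definition adjoint_mat :: "complex^'m^'m \<Rightarrow> complex^'m^'m" where
  "adjoint_mat A = map_matrix cnj (transpose A)"

definition unitary_mat :: "complex^'m^'m \<Rightarrow> bool" where
  "unitary_mat U \<longleftrightarrow> adjoint_mat U ** U = mat 1 \<and> U ** adjoint_mat U = mat 1"

definition diag_mat :: "('m \<Rightarrow> complex) \<Rightarrow> complex^'m^'m" where
  "diag_mat d = (\<chi> i j. if i = j then d i else 0)"

text \<open>The quadratic form \<open>z\<^sup>* A z\<close> is real and nonnegative; over the complex numbers this
  forces \<open>A\<close> to be Hermitian.\<close>

definition nonneg_definite :: "complex^'m^'m \<Rightarrow> bool" where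
  "nonneg_definite A \<longleftrightarrow> (\<forall>z. (\<Sum>i\<in>UNIV. cnj (z $ i) * (A *v z) $ i) \<in> \<real>\<^sub>\<ge>\<^sub>0)"

text \<open>Real powers of a nonnegative definite matrix by the spectral theorem; the result does not
  depend on the diagonalization. Since \<open>0 powr a = 0\<close>, a negative power of a singular matrix is
  the corresponding power of its pseudo-inverse. For a matrix weight this convention only
  concerns a null set of points.\<close>

definition mat_powr :: "complex^'m^'m \<Rightarrow> real \<Rightarrow> complex^'m^'m" where
  "mat_powr A a = (THE B. \<exists>U e. unitary_mat U \<and> (\<forall>i. 0 \<le> e i) \<and>
      A = U ** diag_mat (\<lambda>i. complex_of_real (e i)) ** adjoint_mat U \<and>
      B = U ** diag_mat (\<lambda>i. complex_of_real (e i powr a)) ** adjoint_mat U)"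

definition op_norm :: "complex^'m^'m \<Rightarrow> real" where
  "op_norm A = onorm (\<lambda>v. A *v v)"


section \<open>Cubes\<close>

text \<open>\<open>is_cube c l Q\<close>: \<open>Q\<close> is a product of intervals of length \<open>l\<close>, each open, closed or
  half-open, with center \<open>c\<close>.\<close>

definition is_cube :: "real^'n \<Rightarrow> real \<Rightarrow> (real^'n) set \<Rightarrow> bool" where
  "is_cube c l Q \<longleftrightarrow> 0 < l \<and> (\<exists>I. Q = {x. \<forall>i. x $ i \<in> I i} \<and>
     (\<forall>i. {c $ i - l/2 <..< c $ i + l/2} \<subseteq> I i \<and> I i \<subseteq> {c $ i - l/2 .. c $ i + l/2}))"

definition cubes :: "(real^'n) set set" where
  "cubes = {Q. \<exists>c l. is_cube c l Q}"

definition dilate :: "real^'n \<Rightarrow> real \<Rightarrow> (real^'n) set \<Rightarrow> (real^'n) set" where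
  "dilate c t Q = (\<lambda>x. c + t *\<^sub>R (x - c)) ` Q"


section \<open>Averages\<close>

definition average :: "(real^'n) set \<Rightarrow> (real^'n \<Rightarrow> real) \<Rightarrow> real" where
  "average E f = (LINT x:E|lebesgue. f x) / measure lebesgue E"

text \<open>The average as an extended real, with the integral the difference of the integrals of
  the positive and the negative part. In type \<open>ereal\<close> one has \<open>\<infinity> - \<infinity> = \<infinity>\<close>, so an upper bound
  on \<open>ext_average E f\<close> by a finite number entails that the integral is well defined.\<close>

definition ext_average :: "(real^'n) set \<Rightarrow> (real^'n \<Rightarrow> real) \<Rightarrow> ereal" where
  "ext_average E f =
     (enn2ereal (\<integral>\<^sup>+x\<in>E. ennreal (f x) \<partial>lebesgue) - enn2ereal (\<integral>\<^sup>+x\<in>E. ennreal (- f x) \<partial>lebesgue))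
       / ereal (measure lebesgue E)"

definition ext_exp :: "ereal \<Rightarrow> ereal" where
  "ext_exp z = (case z of ereal r \<Rightarrow> ereal (exp r) | PInfty \<Rightarrow> \<infinity> | MInfty \<Rightarrow> 0)"


section \<open>Matrix weights\<close>

definition locally_integrable :: "(real^'n \<Rightarrow> complex) \<Rightarrow> bool" where
  "locally_integrable f \<longleftrightarrow> (\<forall>K. compact K \<longrightarrow> f absolutely_integrable_on K)"

definition matrix_weight :: "(real^'n \<Rightarrow> complex^'m^'m) \<Rightarrow> bool" where
  "matrix_weight W \<longleftrightarrow>
     (\<forall>x. nonneg_definite (W x)) \<and> (AE x in lebesgue. invertible (W x)) \<and>
     (\<forall>i j. locally_integrable (\<lambda>x. W x $ i $ j))"

text \<open>The average over \<open>x \<in> E\<close> of the \<open>p\<close>-th power of the norm of \<open>W(x)^(1/p) W(y)^(-1/p)\<close>. For a matrix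
  weight and a cube \<open>E\<close> the integrand is bounded by the norm of \<open>W(x)\<close> times a number depending
  on \<open>y\<close>, hence is integrable; the average is positive for almost every \<open>y\<close>, so that
  the convention \<open>ln 0 = 0\<close> is immaterial when its logarithm is integrated in \<open>y\<close>.\<close>

definition weight_avg ::
    "real \<Rightarrow> (real^'n \<Rightarrow> complex^'m^'m) \<Rightarrow> (real^'n) set \<Rightarrow> real^'n \<Rightarrow> real" where
  "weight_avg p W E y =
     average E (\<lambda>x. op_norm (mat_powr (W x) (1/p) ** mat_powr (W y) (-1/p)) powr p)"

definition Ap :: "real \<Rightarrow> (real^'n \<Rightarrow> complex^'m^'m) set" where
  "Ap p = {W. matrix_weight W \<and>
     (SUP Q\<in>cubes. esssup (lebesgue_on Q) (\<lambda>y. ereal (weight_avg p W Q y))) < \<infinity>}"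

definition Ap_inf_const :: "real \<Rightarrow> (real^'n \<Rightarrow> complex^'m^'m) \<Rightarrow> ereal" where
  "Ap_inf_const p W = (SUP Q\<in>cubes. ext_exp (ext_average Q (\<lambda>y. ln (weight_avg p W Q y))))"

definition Ap_inf :: "real \<Rightarrow> (real^'n \<Rightarrow> complex^'m^'m) set" where
  "Ap_inf p = {W. matrix_weight W \<and>
     (\<forall>Q\<in>cubes. (\<lambda>y. max 0 (ln (weight_avg p W Q y))) absolutely_integrable_on Q) \<and>
     Ap_inf_const p W < \<infinity>}"

definition D_upper :: "real \<Rightarrow> real \<Rightarrow> (real^'n \<Rightarrow> complex^'m^'m) set" where
  "D_upper p d = {W. matrix_weight W \<and>
     (\<exists>C>0. \<forall>t\<ge>1. \<forall>c l Q. is_cube c l Q \<longrightarrow>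
        ext_exp (ext_average Q (\<lambda>y. ln (weight_avg p W (dilate c t Q) y)))
          \<le> ereal (C * t powr d))}"

end

theory Submission
  imports Defs
begin

text \<open>Write \<open>f\<^sub>B(x) = \<parallel>W(x)\<^sup>1\<^sup>/\<^sup>p B\<parallel>\<^sup>p\<close> and \<open>w(R, y)\<close> for the average of \<open>f\<^sub>B\<close> over \<open>R\<close> with
  \<open>B = W(y)\<^sup>-\<^sup>1\<^sup>/\<^sup>p\<close>. Submultiplicativity of the norm bounds the average of \<open>f\<^sub>B\<close> over \<open>R\<close> by
  \<open>w(R, y) f\<^sub>B(y)\<close> for almost every \<open>y\<close>. Taking logarithms and applying Jensen's inequality, a
  bound \<open>L\<close> for the average over \<open>Q\<close> of \<open>log w(R, y)\<close> makes the average of \<open>f\<^sub>B\<close> over \<open>R\<close> at most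
  \<open>e\<^sup>L\<close> times that over \<open>Q\<close>. For \<open>R = \<lambda>Q\<close> and \<open>d < 0\<close> this contradicts the Lebesgue differentiation
  theorem.

  Taking \<open>B\<close> to be the identity, the same pointwise bound shows that the negative part of
  \<open>log w(R, y)\<close> has average at most \<open>1\<close> over \<open>R\<close>. Hence for an \<open>A\<close>-infinity weight the positive part
  has bounded average over \<open>R\<close>, so \<open>log w(2Q, y)\<close> has bounded averages over \<open>Q\<close>, and the densities
  \<open>f\<^sub>B\<close> are doubling uniformly in \<open>B\<close>. Iterating yields \<open>w(\<lambda>Q, y) \<le> C \<lambda>\<^sup>d w(Q, y)\<close>.

  The weight \<open>\<bar>x\<bar>\<^sup>d\<close> times the identity separates the classes in \<open>d\<close>.\<close>


section \<open>Powers of nonnegative definite matrices\<close>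

text \<open>The complex inner product, conjugate-linear in the first argument. The library's
  \<open>inner\<close> on complex vectors is only its real part, which does not detect orthogonality
  over the complex numbers.\<close>

definition cip :: "complex^'m \<Rightarrow> complex^'m \<Rightarrow> complex" where
  "cip x y = (\<Sum>i\<in>UNIV. cnj (x $ i) * y $ i)"

lemma cip_simps:
  "cip (x + y) z = cip x z + cip y z" "cip z (x + y) = cip z x + cip z y"
  "cip (x - y) z = cip x z - cip y z" "cip z (x - y) = cip z x - cip z y"
  "cip (c *s x) z = cnj c * cip x z" "cip z (c *s x) = c * cip z x"
  "cip 0 z = 0" "cip z 0 = 0" "cnj (cip x y) = cip y x"
  by (auto simp: cip_def algebra_simps sum.distrib sum_subtractf sum_distrib_left)

lemma Re_cip: "Re (cip x y) = x \<bullet> y"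
  by (simp add: cip_def inner_vec_def inner_complex_def)

lemma cip_self: "cip x x = complex_of_real ((norm x)\<^sup>2)"
proof -
  have "cip x x \<in> \<real>" by (simp add: complex_is_Real_iff cip_def mult.commute)
  then show ?thesis
    by (metis Re_cip complex_of_real_def dot_square_norm of_real_Re)
qed

lemma continuous_on_cip [continuous_intros]:
  assumes "continuous_on S f" "continuous_on S g"
  shows "continuous_on S (\<lambda>x. cip (f x) (g x))"
  unfolding cip_def by (intro continuous_intros assms)

lemma nonneg_definite_iff_cip: "nonneg_definite A \<longleftrightarrow> (\<forall>z. cip z (A *v z) \<in> \<real>\<^sub>\<ge>\<^sub>0)"
  by (simp add: nonneg_definite_def cip_def)

text \<open>Polarization: the forms at \<open>x + y\<close> and \<open>x + \<i> y\<close> are real.\<close>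

lemma nonneg_definite_hermitian:
  assumes "nonneg_definite A"
  shows "cip x (A *v y) = cip (A *v x) y"
proof -
  have real: "Im (cip z (A *v z)) = 0" for z
    using assms complex_nonneg_Reals_iff unfolding nonneg_definite_iff_cip by blast
  have "Im (cip (x + y) (A *v (x + y))) = 0" "Im (cip (x + \<i> *s y) (A *v (x + \<i> *s y))) = 0"
    by (simp_all only: real)
  then have "Im (cip x (A *v y)) = - Im (cip y (A *v x))"
    "Re (cip x (A *v y)) = Re (cip y (A *v x))"
    using real[of x] real[of y]
    by (simp_all add: cip_simps algebra_simps vector_scalar_commute)
  then have "cip x (A *v y) = cnj (cip y (A *v x))"
    by (simp add: complex_eq_iff)
  then show ?thesis by (simp add: cip_simps)
qed

text \<open>The matrix with rows conjugate to \<open>u i\<close> for \<open>i\<close> in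
  \<open>K\<close> and zero rows elsewhere is singular, since its row \<open>j\<close> vanishes. A
  kernel vector is orthogonal to all the given vectors.\<close>

lemma exists_orthogonal:
  fixes u :: "'m::finite \<Rightarrow> complex^'m"
  assumes "j \<notin> K"
  shows "\<exists>z. z \<noteq> 0 \<and> (\<forall>i\<in>K. cip (u i) z = 0)"
proof -
  define M :: "complex^'m^'m" where "M = (\<chi> i k. if i \<in> K then cnj (u i $ k) else 0)"
  have "(B ** M) \<noteq> mat 1" for B
  proof
    assume "B ** M = mat 1"
    then have "M ** B = mat 1" using matrix_left_right_inverse by blast
    then have "(M ** B) $ j $ j = 1" by (simp add: mat_def)
    then show False using assms by (simp add: M_def matrix_matrix_mult_def)
  qed
  then obtain z where "M *v z = 0" "z \<noteq> 0" using matrix_left_invertible_ker by metis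
  moreover have "(M *v z) $ i = cip (u i) z" if "i \<in> K" for i
    using that by (simp add: M_def matrix_vector_mult_def cip_def)
  ultimately show ?thesis by (metis zero_index)
qed

text \<open>Maximize the quadratic form of \<open>A\<close> over the unit vectors orthogonal to the
  given eigenvectors. This orthogonal complement is invariant because \<open>A\<close> is Hermitian,
  and the first-order condition at a maximizer is the eigenvalue equation.\<close>

lemma exists_eigenvector_orthogonal:
  fixes A :: "complex^'m^'m" and u :: "'m \<Rightarrow> complex^'m"
  assumes A: "nonneg_definite A" and "j \<notin> K"
    and eig: "\<And>i. i \<in> K \<Longrightarrow> A *v u i = complex_of_real (e i) *s u i"
  shows "\<exists>z \<mu>. norm z = 1 \<and> (\<forall>i\<in>K. cip (u i) z = 0) \<and> 0 \<le> \<mu> \<and> A *v z = complex_of_real \<mu> *s z"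
proof -
  define S where "S = {z. \<forall>i\<in>K. cip (u i) z = 0}"
  define q where "q z = z \<bullet> (A *v z)" for z
  have q_nonneg: "0 \<le> q z" for z
    using A unfolding nonneg_definite_iff_cip q_def
    by (metis Re_cip complex_nonneg_Reals_iff)
  have S_scale: "c *\<^sub>R z \<in> S" if "z \<in> S" for c z
    using that by (simp add: S_def cip_def flip: scaleR_sum_right)
  have S_add: "z + w \<in> S" if "z \<in> S" "w \<in> S" for w z
    using that by (simp add: S_def cip_simps)
  have "closed S"
  proof -
    have "S = (\<Inter>i\<in>K. (\<lambda>z. cip (u i) z) -` {0})" by (auto simp: S_def)
    also have "closed \<dots>"
      by (intro closed_INT ballI closed_vimage continuous_intros)
    finally show ?thesis .
  qed
  then have comp: "compact (S \<inter> sphere 0 1)" by (simp add: closed_Int_compact)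
  obtain z0 where z0: "z0 \<noteq> 0" "z0 \<in> S"
    using exists_orthogonal[OF \<open>j \<notin> K\<close>, of u] by (auto simp: S_def)
  have "(inverse (norm z0)) *\<^sub>R z0 \<in> S \<inter> sphere 0 1" using z0 S_scale by simp
  then have ne: "S \<inter> sphere 0 1 \<noteq> {}" by blast
  have cont: "continuous_on T q" for T
    unfolding q_def by (intro continuous_intros linear_continuous_on) auto
  obtain z where z: "z \<in> S" "norm z = 1" and max: "\<And>w. w \<in> S \<Longrightarrow> norm w = 1 \<Longrightarrow> q w \<le> q z"
    using continuous_attains_sup[OF comp ne cont] by auto
  define \<mu> where "\<mu> = q z"
  have Ascale: "A *v (c *\<^sub>R w) = c *\<^sub>R (A *v w)" for c w
    using linear_scale[OF matrix_vector_mul_linear] by blast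
  have qscale: "q (c *\<^sub>R w) = c\<^sup>2 * q w" for c w
    by (simp add: q_def Ascale power2_eq_square)
  have bound: "q w \<le> \<mu> * (norm w)\<^sup>2" if "w \<in> S" for w
  proof (cases "w = 0")
    case False
    have "q (inverse (norm w) *\<^sub>R w) \<le> \<mu>"
      unfolding \<mu>_def using that False by (intro max S_scale) auto
    then show ?thesis using False by (simp add: qscale field_simps)
  qed (simp add: q_def)
  \<comment> \<open>The defect in the eigenvalue equation. It lies in the invariant space
    \<open>S\<close>, so \<open>z + t *\<^sub>R r\<close> is an admissible competitor.\<close>
  define r where "r = A *v z - complex_of_real \<mu> *s z"
  have r_scaleR: "r = A *v z - \<mu> *\<^sub>R z"
    unfolding r_def by (simp add: vec_eq_iff) (simp add: scaleR_conv_of_real)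
  have "cip (u i) (A *v z) = 0" if "i \<in> K" for i
    using that z(1) by (simp add: nonneg_definite_hermitian[OF A] eig cip_simps S_def)
  then have rS: "r \<in> S" using z(1) by (simp add: r_def S_def cip_simps)
  have sym: "x \<bullet> (A *v y) = (A *v x) \<bullet> y" for x y
    by (metis nonneg_definite_hermitian[OF A] Re_cip)
  have "r = 0"
  proof (rule ccontr)
    assume "r \<noteq> 0"
    \<comment> \<open>Comparing the form at \<open>z + t *\<^sub>R r\<close> with the maximum leaves
      a linear gain in \<open>t\<close> on the left and a quadratic cost on the right; the
      nonnegative term with \<open>q r\<close> is dropped.\<close>
    have *: "2 * t * (norm r)\<^sup>2 \<le> t\<^sup>2 * (\<mu> * (norm r)\<^sup>2)" for t :: real
    proof -
      have zz: "z \<bullet> z = 1" using z(2) by (simp add: norm_eq_sqrt_inner)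
      have 1: "q (z + t *\<^sub>R r) \<le> \<mu> * (norm (z + t *\<^sub>R r))\<^sup>2"
        by (intro bound S_add S_scale z rS)
      have 2: "q (z + t *\<^sub>R r) = \<mu> + 2 * t * (r \<bullet> (A *v z)) + t\<^sup>2 * q r"
        using sym[of z r] by (simp add: q_def \<mu>_def matrix_vector_right_distrib Ascale
            inner_add_left inner_add_right power2_eq_square inner_commute[of "A *v z" r] distrib_left)
      have 3: "(norm (z + t *\<^sub>R r))\<^sup>2 = 1 + 2 * t * (r \<bullet> z) + t\<^sup>2 * (norm r)\<^sup>2"
        using zz by (simp add: power2_norm_eq_inner inner_add_left inner_add_right
            inner_commute[of z r] power2_eq_square[of t] distrib_left)
      have 4: "(norm r)\<^sup>2 = r \<bullet> (A *v z) - \<mu> * (r \<bullet> z)"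
        unfolding dot_square_norm[symmetric] by (subst (2) r_scaleR) (simp add: inner_diff_right)
      have 5: "0 \<le> t\<^sup>2 * q r" using q_nonneg by simp
      have "2 * t * (norm r)\<^sup>2 = 2 * t * (r \<bullet> (A *v z)) - \<mu> * (2 * t * (r \<bullet> z))"
        unfolding 4 by (simp add: algebra_simps)
      moreover have "\<mu> * (norm (z + t *\<^sub>R r))\<^sup>2 = \<mu> + \<mu> * (2 * t * (r \<bullet> z)) + t\<^sup>2 * (\<mu> * (norm r)\<^sup>2)"
        unfolding 3 by (simp add: algebra_simps)
      ultimately show ?thesis using 1 2 5 by linarith
    qed
    have mu: "0 \<le> \<mu>" using q_nonneg \<mu>_def by simp
    \<comment> \<open>Small enough that \<open>s * \<mu> < 2\<close>, so the linear gain at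
      \<open>t = s\<close> exceeds the quadratic cost.\<close>
    define s where "s = 1 / (\<mu> + 1)"
    have s: "0 < s" "s * \<mu> < 1" using mu by (auto simp: s_def field_simps)
    have "0 < s * (norm r)\<^sup>2 * (2 - s * \<mu>)" using s \<open>r \<noteq> 0\<close> by simp
    moreover have "s * (norm r)\<^sup>2 * (2 - s * \<mu>) = 2 * s * (norm r)\<^sup>2 - s\<^sup>2 * (\<mu> * (norm r)\<^sup>2)"
      by (simp add: algebra_simps power2_eq_square)
    ultimately show False using *[of s] by linarith
  qed
  then have "A *v z = complex_of_real \<mu> *s z" by (simp add: r_def)
  moreover have "\<forall>i\<in>K. cip (u i) z = 0" using z by (simp add: S_def)
  moreover have "0 \<le> \<mu>" using q_nonneg \<mu>_def by simp
  ultimately show ?thesis using z(2) by blast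
qed

section \<open>Diagonalization and functional calculus\<close>

lemma diag_mat_mult:
  "(A ** diag_mat d) $ i $ j = A $ i $ j * d j" "(diag_mat d ** A) $ i $ j = d i * A $ i $ j"
  by (simp_all add: matrix_matrix_mult_def diag_mat_def if_distrib if_distribR
      cong: if_cong)

text \<open>An orthonormal family of eigenvectors indexed by a subset \<open>K\<close> of the index
  type is extended one index at a time. For \<open>K = UNIV\<close> its members are the columns of
  \<open>U\<close>.\<close>

theorem spectral_theorem_nonneg_definite:
  fixes A :: "complex^'m^'m"
  assumes A: "nonneg_definite A"
  obtains U e where "unitary_mat U" "\<And>i. 0 \<le> e i"
    "A = U ** diag_mat (\<lambda>i. complex_of_real (e i)) ** adjoint_mat U"
proof -
  have "\<exists>u e. (\<forall>i\<in>K. A *v u i = complex_of_real (e i) *s u i \<and> 0 \<le> e i \<and> norm (u i) = 1) \<and>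
      (\<forall>i\<in>K. \<forall>k\<in>K. i \<noteq> k \<longrightarrow> cip (u i) (u k) = 0)" for K :: "'m set"
    using finite[of K]
  proof (induction K rule: finite_induct)
    case (insert j K)
    obtain u e where ue: "\<forall>i\<in>K. A *v u i = complex_of_real (e i) *s u i \<and> 0 \<le> e i \<and> norm (u i) = 1"
      "\<forall>i\<in>K. \<forall>k\<in>K. i \<noteq> k \<longrightarrow> cip (u i) (u k) = 0"
      using insert.IH by (elim exE conjE)
    have eig: "\<And>i. i \<in> K \<Longrightarrow> A *v u i = complex_of_real (e i) *s u i" using ue by simp
    obtain z \<mu> where z: "norm z = 1" "\<forall>i\<in>K. cip (u i) z = 0" "0 \<le> \<mu>" "A *v z = complex_of_real \<mu> *s z"
      using exists_eigenvector_orthogonal[where u = u and e = e, OF A insert(2)] eig by metis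
    have "cip z (u i) = 0" if "i \<in> K" for i
      using z(2) that by (metis cip_simps(9) complex_cnj_zero)
    then show ?case
      using ue z insert(2) by (intro exI[of _ "u(j := z)"] exI[of _ "e(j := \<mu>)"] conjI ballI) auto
  qed simp
  from this[of UNIV] obtain u :: "'m \<Rightarrow> complex^'m" and e where
    ue: "\<forall>i. A *v u i = complex_of_real (e i) *s u i \<and> 0 \<le> e i \<and> norm (u i) = 1"
    and orth': "\<forall>i k. i \<noteq> k \<longrightarrow> cip (u i) (u k) = 0" by auto
  have eig: "\<And>i. A *v u i = complex_of_real (e i) *s u i" and nonneg: "\<And>i. 0 \<le> e i"
    and unit: "\<And>i. norm (u i) = 1" and orth: "\<And>i k. i \<noteq> k \<Longrightarrow> cip (u i) (u k) = 0"
    using ue orth' by simp_all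
  define U :: "complex^'m^'m" where "U = (\<chi> a i. u i $ a)"
  have "adjoint_mat U ** U = mat 1"
  proof -
    have "(adjoint_mat U ** U) $ i $ k = cip (u i) (u k)" for i k
      by (simp add: adjoint_mat_def matrix_matrix_mult_def transpose_def U_def cip_def)
    then show ?thesis using orth unit by (simp add: vec_eq_iff mat_def cip_self)
  qed
  then have U: "unitary_mat U"
    using matrix_left_right_inverse unfolding unitary_mat_def by blast
  have "(A ** U) $ a $ i = (U ** diag_mat (\<lambda>i. complex_of_real (e i))) $ a $ i" for a i
  proof -
    have "(A ** U) $ a $ i = (A *v u i) $ a"
      by (simp add: matrix_matrix_mult_def matrix_vector_mult_def U_def)
    then show ?thesis by (simp add: eig diag_mat_mult U_def mult.commute)
  qed
  then have "A ** U = U ** diag_mat (\<lambda>i. complex_of_real (e i))" by (simp add: vec_eq_iff)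
  then have "A = U ** diag_mat (\<lambda>i. complex_of_real (e i)) ** adjoint_mat U"
    using U unfolding unitary_mat_def by (metis matrix_mul_assoc matrix_mul_rid)
  then show thesis using that U nonneg by blast
qed

text \<open>The matrix \<open>T = adjoint_mat V ** U\<close> intertwines the two diagonal matrices,
  so its entry at \<open>i\<close>, \<open>j\<close> can be nonzero only if
  \<open>d j = e i\<close>. Hence \<open>T\<close> also intertwines their images under
  \<open>f\<close>.\<close>

lemma functional_calculus_unique:
  assumes U: "unitary_mat U" and V: "unitary_mat V"
    and eq: "U ** diag_mat (\<lambda>i. complex_of_real (d i)) ** adjoint_mat U
      = V ** diag_mat (\<lambda>i. complex_of_real (e i)) ** adjoint_mat V"
  shows "U ** diag_mat (\<lambda>i. complex_of_real (f (d i))) ** adjoint_mat U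
      = V ** diag_mat (\<lambda>i. complex_of_real (f (e i))) ** adjoint_mat V"
proof -
  define T where "T = adjoint_mat V ** U"
  have TU: "adjoint_mat V ** (U ** D ** adjoint_mat U) ** U = T ** D" for D
    using U by (simp add: T_def unitary_mat_def matrix_mul_assoc[symmetric])
  have TV: "adjoint_mat V ** (V ** E ** adjoint_mat V) ** U = E ** T" for E
    using V by (simp add: T_def unitary_mat_def matrix_mul_assoc)
  have "T ** diag_mat (\<lambda>i. complex_of_real (d i)) = diag_mat (\<lambda>i. complex_of_real (e i)) ** T"
    using TU TV eq by metis
  then have "T $ i $ j * complex_of_real (d j) = complex_of_real (e i) * T $ i $ j" for i j
    by (metis diag_mat_mult)
  then have "T $ i $ j = 0 \<or> d j = e i" for i j
    by (metis mult.commute mult_left_cancel of_real_eq_iff)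
  then have "T $ i $ j * complex_of_real (f (d j)) = complex_of_real (f (e i)) * T $ i $ j" for i j
    by (metis mult.commute mult_zero_left)
  then have "T ** diag_mat (\<lambda>i. complex_of_real (f (d i))) = diag_mat (\<lambda>i. complex_of_real (f (e i))) ** T"
    by (simp add: vec_eq_iff diag_mat_mult)
  then have "V ** (T ** diag_mat (\<lambda>i. complex_of_real (f (d i)))) ** adjoint_mat U
    = V ** (diag_mat (\<lambda>i. complex_of_real (f (e i))) ** T) ** adjoint_mat U" by simp
  moreover have "V ** (T ** D) ** adjoint_mat U = U ** D ** adjoint_mat U" for D
    using V by (simp add: T_def unitary_mat_def matrix_mul_assoc)
  moreover have "V ** (E ** T) ** adjoint_mat U = V ** E ** adjoint_mat V" for E
    using U by (simp add: T_def unitary_mat_def matrix_mul_assoc[symmetric])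
  ultimately show ?thesis by simp
qed

text \<open>This makes the definite description in \<open>mat_powr\<close> usable: any
  diagonalization is a witness, and \<open>functional_calculus_unique\<close> shows that all of them
  yield the same power.\<close>

lemma mat_powr_eq:
  assumes "unitary_mat U" "\<And>i. 0 \<le> e i"
    "A = U ** diag_mat (\<lambda>i. complex_of_real (e i)) ** adjoint_mat U"
  shows "mat_powr A a = U ** diag_mat (\<lambda>i. complex_of_real (e i powr a)) ** adjoint_mat U"
  unfolding mat_powr_def
proof (rule the_equality)
  show "\<exists>U' e'. unitary_mat U' \<and> (\<forall>i. 0 \<le> e' i) \<and>
      A = U' ** diag_mat (\<lambda>i. complex_of_real (e' i)) ** adjoint_mat U' \<and>
      U ** diag_mat (\<lambda>i. complex_of_real (e i powr a)) ** adjoint_mat U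
      = U' ** diag_mat (\<lambda>i. complex_of_real (e' i powr a)) ** adjoint_mat U'"
    using assms by blast
next
  fix B assume "\<exists>V d. unitary_mat V \<and> (\<forall>i. 0 \<le> d i) \<and>
      A = V ** diag_mat (\<lambda>i. complex_of_real (d i)) ** adjoint_mat V \<and>
      B = V ** diag_mat (\<lambda>i. complex_of_real (d i powr a)) ** adjoint_mat V"
  then show "B = U ** diag_mat (\<lambda>i. complex_of_real (e i powr a)) ** adjoint_mat U"
    using functional_calculus_unique[of _ U _ e "\<lambda>t. t powr a"] assms by metis
qed

section \<open>The operator norm\<close>

lemma norm_smult: "norm (c *s x) = norm c * norm x" for c :: complex
  by (simp add: norm_vec_def norm_mult L2_set_right_distrib)

lemma unitary_norm:
  assumes "unitary_mat U" shows "norm (U *v x) = norm x"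
proof -
  have adj: "cip (adjoint_mat U *v y) z = cip y (U *v z)" for y z
    by (simp add: cip_def adjoint_mat_def transpose_def matrix_vector_mult_def sum_distrib_left
        sum_distrib_right mult.assoc mult.left_commute) (subst sum.swap, simp add: mult_ac)
  have "cip (U *v x) (U *v x) = cip x x"
    using adj[of "U *v x" x] assms by (simp add: unitary_mat_def matrix_vector_mul_assoc)
  then have "(norm (U *v x))\<^sup>2 = (norm x)\<^sup>2" unfolding cip_self of_real_eq_iff .
  then show ?thesis by simp
qed

lemma unitary_adjoint:
  assumes "unitary_mat U" shows "unitary_mat (adjoint_mat U)"
proof -
  have "adjoint_mat (adjoint_mat U) = U" by (simp add: adjoint_mat_def transpose_def vec_eq_iff)
  with assms show ?thesis by (simp add: unitary_mat_def)
qed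

lemma norm_diag_mat_mult:
  assumes "\<And>i. norm (d i) \<le> b"
  shows "norm (diag_mat d *v x) \<le> b * norm x"
proof -
  have "0 \<le> b" using assms norm_ge_zero order_trans by blast
  have "(diag_mat d *v x) $ i = d i * x $ i" for i
    by (simp add: diag_mat_def matrix_vector_mult_def if_distrib if_distribR cong: if_cong)
  then have "norm (diag_mat d *v x) = L2_set (\<lambda>i. norm (d i) * norm (x $ i)) UNIV"
    by (simp add: norm_vec_def norm_mult)
  also have "\<dots> \<le> L2_set (\<lambda>i. b * norm (x $ i)) UNIV"
    by (intro L2_set_mono mult_right_mono assms) auto
  also have "\<dots> = b * norm x"
    using \<open>0 \<le> b\<close> by (simp add: L2_set_right_distrib norm_vec_def)
  finally show ?thesis .
qed

lemma matrix_axis: "(A *v axis j 1) $ i = A $ i $ j" for A :: "complex^'m^'m"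
  by (simp add: matrix_vector_mult_def axis_def if_distrib if_distribR cong: if_cong)

lemma op_norm_bound: "norm (A *v x) \<le> op_norm A * norm x"
  unfolding op_norm_def by (rule onorm) auto

lemma op_norm_nonneg: "0 \<le> op_norm A"
  unfolding op_norm_def by (rule onorm_pos_le) auto

lemma op_norm_le: "(\<And>x. norm (A *v x) \<le> b * norm x) \<Longrightarrow> op_norm A \<le> b"
  unfolding op_norm_def by (rule onorm_le) auto

lemma op_norm_mult: "op_norm (A ** B) \<le> op_norm A * op_norm B"
proof (rule op_norm_le)
  fix x
  have "norm ((A ** B) *v x) \<le> op_norm A * norm (B *v x)"
    unfolding matrix_vector_mul_assoc[symmetric] by (rule op_norm_bound)
  also have "\<dots> \<le> op_norm A * (op_norm B * norm x)"
    by (intro mult_left_mono op_norm_bound op_norm_nonneg)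
  finally show "norm ((A ** B) *v x) \<le> op_norm A * op_norm B * norm x" by (simp add: mult.assoc)
qed

lemma op_norm_mat: "op_norm (mat (complex_of_real c) :: complex^'m^'m) = \<bar>c\<bar>"
proof -
  have eq: "(mat (complex_of_real c) :: complex^'m^'m) *v x = c *\<^sub>R x" for x
    by (simp add: vec_eq_iff mat_def matrix_vector_mult_def if_distrib if_distribR cong: if_cong)
      (simp add: scaleR_conv_of_real)
  show ?thesis
  proof (rule antisym)
    show "op_norm (mat (complex_of_real c) :: complex^'m^'m) \<le> \<bar>c\<bar>"
      by (rule op_norm_le) (simp add: eq)
    show "\<bar>c\<bar> \<le> op_norm (mat (complex_of_real c) :: complex^'m^'m)"
      using op_norm_bound[of "mat (complex_of_real c) :: complex^'m^'m" "axis undefined 1"]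
      by (simp add: eq)
  qed
qed

text \<open>Expand \<open>x\<close> in the standard basis and bound each coordinate by
  \<open>norm x\<close>. This transfers control of the entries of a weight to its operator
  norm.\<close>

lemma op_norm_le_columns: "op_norm A \<le> (\<Sum>j\<in>UNIV. norm (A *v axis j 1))"
proof (rule op_norm_le)
  fix x
  have "A *v x = (\<Sum>j\<in>UNIV. x $ j *s (A *v axis j 1))"
    by (subst basis_expansion[of x, symmetric])
      (simp add: linear_sum[OF matrix_vector_mul_linear] vector_scalar_commute)
  also have "norm \<dots> \<le> (\<Sum>j\<in>UNIV. norm (x $ j *s (A *v axis j 1)))" by (rule norm_sum)
  also have "\<dots> = (\<Sum>j\<in>UNIV. norm (x $ j) * norm (A *v axis j 1))"
    by (simp add: norm_smult)
  also have "\<dots> \<le> (\<Sum>j\<in>UNIV. norm x * norm (A *v axis j 1))"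
    by (intro sum_mono mult_right_mono Finite_Cartesian_Product.norm_nth_le norm_ge_zero)
  finally show "norm (A *v x) \<le> (\<Sum>j\<in>UNIV. norm (A *v axis j 1)) * norm x"
    by (simp add: sum_distrib_left sum_distrib_right mult.commute)
qed

text \<open>Each column is bounded by the Frobenius norm; the factor counts the columns. Applied to
  differences, this yields a Lipschitz bound for \<open>op_norm\<close>.\<close>

lemma op_norm_le_norm: "op_norm A \<le> real CARD('m) * norm (A :: complex^'m^'m)"
proof -
  have "norm (A *v axis j 1) \<le> norm A" for j
  proof -
    have "norm (A *v axis j 1) = L2_set (\<lambda>i. norm (A $ i $ j)) UNIV"
      by (simp add: norm_vec_def[of "A *v axis j 1"] matrix_axis)
    also have "\<dots> \<le> L2_set (\<lambda>i. norm (A $ i)) UNIV"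
      by (intro L2_set_mono Finite_Cartesian_Product.norm_nth_le norm_ge_zero)
    finally show ?thesis by (simp add: norm_vec_def)
  qed
  then have "(\<Sum>j\<in>UNIV. norm (A *v axis j 1)) \<le> (\<Sum>j\<in>(UNIV::'m set). norm A)"
    by (intro sum_mono) auto
  then show ?thesis using op_norm_le_columns[of A] by simp
qed

lemma op_norm_triangle: "op_norm (A + B) \<le> op_norm A + op_norm B"
proof (rule op_norm_le)
  fix x
  show "norm ((A + B) *v x) \<le> (op_norm A + op_norm B) * norm x"
    using norm_triangle_ineq[of "A *v x" "B *v x"] op_norm_bound[of A x] op_norm_bound[of B x]
    by (simp add: algebra_simps)
qed

lemma continuous_on_op_norm: "continuous_on S (op_norm :: complex^'m^'m \<Rightarrow> real)"
proof -
  have "\<bar>op_norm A - op_norm B\<bar> \<le> real CARD('m) * dist A B" for A B :: "complex^'m^'m"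
    using op_norm_triangle[of "A - B" B] op_norm_triangle[of "B - A" A]
      op_norm_le_norm[of "A - B"] op_norm_le_norm[of "B - A"]
    by (simp add: dist_norm norm_minus_commute)
  then have "(real CARD('m))-lipschitz_on S (op_norm :: complex^'m^'m \<Rightarrow> real)"
    by (intro lipschitz_onI) (auto simp: dist_real_def)
  then show ?thesis by (rule lipschitz_on_continuous_on)
qed

text \<open>Invertibility excludes the eigenvalue zero, for which the convention
  \<open>0 powr a = 0\<close> would spoil the cancellation of opposite powers.\<close>

lemma mat_powr_inverse:
  assumes "nonneg_definite A" "invertible A"
  shows "mat_powr A a ** mat_powr A (- a) = mat 1"
proof -
  obtain U e where U: "unitary_mat U" and e: "\<And>i. 0 \<le> e i"
    and A: "A = U ** diag_mat (\<lambda>i. complex_of_real (e i)) ** adjoint_mat U"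
    using spectral_theorem_nonneg_definite[OF assms(1)] by metis
  obtain B where B: "A ** B = mat 1" "B ** A = mat 1" using assms(2) by (auto simp: invertible_def)
  \<comment> \<open>A zero eigenvalue would make column \<open>i\<close> of \<open>A ** U\<close>
    vanish, whereas multiplying by \<open>B\<close> and then by \<open>adjoint_mat U\<close> must
    return the identity.\<close>
  have "e i \<noteq> 0" for i
  proof
    assume 0: "e i = 0"
    have "A ** U = U ** diag_mat (\<lambda>i. complex_of_real (e i))"
      unfolding A using U by (simp add: unitary_mat_def matrix_mul_assoc[symmetric])
    then have "(A ** U) $ a $ i = 0" for a by (simp add: diag_mat_mult 0)
    then have "(adjoint_mat U ** (B ** (A ** U))) $ i $ i = 0"
      by (simp add: matrix_matrix_mult_def[of B] matrix_matrix_mult_def[of "adjoint_mat U"])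
    moreover have "adjoint_mat U ** (B ** (A ** U)) = mat 1"
      using U B by (simp add: unitary_mat_def matrix_mul_assoc)
    ultimately show False by (simp add: mat_def)
  qed
  then have pos: "0 < e i" for i using e[of i] by (simp add: less_le)
  have D: "diag_mat (\<lambda>i. complex_of_real (e i powr a)) ** diag_mat (\<lambda>i. complex_of_real (e i powr - a)) = mat 1"
    using less_imp_neq[OF pos]
    by (auto simp: vec_eq_iff diag_mat_mult mat_def powr_minus) (auto simp: diag_mat_def)
  have "mat_powr A a ** mat_powr A (- a) =
      U ** diag_mat (\<lambda>i. complex_of_real (e i powr a)) ** (adjoint_mat U ** U) **
      diag_mat (\<lambda>i. complex_of_real (e i powr - a)) ** adjoint_mat U"
    unfolding mat_powr_eq[OF U e A] by (simp add: matrix_mul_assoc)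
  also have "\<dots> = U ** (diag_mat (\<lambda>i. complex_of_real (e i powr a)) **
      diag_mat (\<lambda>i. complex_of_real (e i powr - a))) ** adjoint_mat U"
    using U by (simp add: unitary_mat_def matrix_mul_assoc)
  also have "\<dots> = mat 1" using U by (simp add: D unitary_mat_def)
  finally show ?thesis .
qed

text \<open>The columns of \<open>U\<close> are unit eigenvectors, so every eigenvalue is at most
  \<open>op_norm A\<close>; monotonicity of \<open>t powr (1/p)\<close> passes this to the root. It
  makes the densities integrable, because \<open>W\<close> is.\<close>

lemma op_norm_mat_powr_le:
  assumes "nonneg_definite A" "0 < p"
  shows "op_norm (mat_powr A (1/p)) powr p \<le> op_norm A"
proof -
  obtain U e where U: "unitary_mat U" and e: "\<And>i. 0 \<le> e i"
    and A: "A = U ** diag_mat (\<lambda>i. complex_of_real (e i)) ** adjoint_mat U"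
    using spectral_theorem_nonneg_definite[OF assms(1)] by metis
  have e_le: "e i \<le> op_norm A" for i
  proof -
    have "A *v (U *v axis i 1) = U *v (diag_mat (\<lambda>i. complex_of_real (e i)) *v axis i 1)"
      unfolding A matrix_vector_mul_assoc using U
      by (simp add: unitary_mat_def matrix_mul_assoc[symmetric])
    also have "diag_mat (\<lambda>i. complex_of_real (e i)) *v axis i 1 = complex_of_real (e i) *s axis i 1"
      by (simp add: vec_eq_iff matrix_axis) (simp add: diag_mat_def axis_def)
    finally have "norm (A *v (U *v axis i 1)) = norm (U *v (complex_of_real (e i) *s axis i 1))" by simp
    then have "e i = norm (A *v (U *v axis i 1))"
      using e[of i] by (simp add: unitary_norm[OF U] norm_smult)
    also have "\<dots> \<le> op_norm A * norm (U *v axis i 1)" by (rule op_norm_bound)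
    finally show ?thesis by (simp add: unitary_norm[OF U])
  qed
  have "op_norm (mat_powr A (1/p)) \<le> op_norm A powr (1/p)"
  proof (rule op_norm_le)
    fix x
    have "norm (mat_powr A (1/p) *v x) =
      norm (diag_mat (\<lambda>i. complex_of_real (e i powr (1/p))) *v (adjoint_mat U *v x))"
      unfolding mat_powr_eq[OF U e A] by (simp add: matrix_vector_mul_assoc[symmetric] unitary_norm[OF U])
    also have "\<dots> \<le> op_norm A powr (1/p) * norm (adjoint_mat U *v x)"
      using e_le e assms by (intro norm_diag_mat_mult) (auto intro!: powr_mono2)
    finally show "norm (mat_powr A (1/p) *v x) \<le> op_norm A powr (1/p) * norm x"
      by (simp add: unitary_norm[OF unitary_adjoint[OF U]])
  qed
  then have "op_norm (mat_powr A (1/p)) powr p \<le> (op_norm A powr (1/p)) powr p"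
    using assms by (intro powr_mono2 op_norm_nonneg) auto
  also have "\<dots> = op_norm A" using assms op_norm_nonneg[of A] by (simp add: powr_powr)
  finally show ?thesis .
qed


section \<open>Measurability of matrix powers\<close>

text \<open>On the spectrum, \<open>t powr a\<close> is a pointwise limit of polynomials, so that a matrix power is a
  pointwise limit of polynomials in the matrix, which are continuous.\<close>

definition mat_poly :: "(nat \<Rightarrow> real) \<Rightarrow> nat \<Rightarrow> complex^'m^'m \<Rightarrow> complex^'m^'m" where
  "mat_poly c n A = (\<Sum>i\<le>n. c i *\<^sub>R (((**) A ^^ i) (mat 1)))"

lemma continuous_on_mat_poly: "continuous_on S (mat_poly c n :: complex^'m^'m \<Rightarrow> _)"
proof -
  have "continuous_on S (\<lambda>A::complex^'m^'m. ((**) A ^^ i) (mat 1))" for i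
  proof (induction i)
    case (Suc i)
    then show ?case
      by (simp add: matrix_matrix_mult_def) (intro continuous_intros; simp)
  qed simp
  then show ?thesis unfolding mat_poly_def by (intro continuous_intros)
qed

lemma conjugate_diag_entry:
  fixes U V :: "complex^'m^'m"
  shows
  "(U ** diag_mat d ** V :: complex^'m^'m) $ i $ j = (\<Sum>k\<in>UNIV. U $ i $ k * d k * V $ k $ j)"
  unfolding matrix_matrix_mult_def[of "U ** diag_mat d"] by (simp add: diag_mat_mult)

text \<open>In each power of the conjugated matrix the inner factors
  \<open>adjoint_mat U ** U\<close> cancel, so the polynomial acts on the eigenvalues.\<close>

lemma mat_poly_conjugate:
  assumes U: "unitary_mat U"
  shows "mat_poly c n (U ** diag_mat (\<lambda>i. complex_of_real (e i)) ** adjoint_mat U)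
    = U ** diag_mat (\<lambda>i. complex_of_real (\<Sum>k\<le>n. c k * e i ^ k)) ** adjoint_mat U"
proof -
  let ?A = "U ** diag_mat (\<lambda>i. complex_of_real (e i)) ** adjoint_mat U"
  have pow: "((**) ?A ^^ k) (mat 1) = U ** diag_mat (\<lambda>i. complex_of_real (e i ^ k)) ** adjoint_mat U" for k
  proof (induction k)
    case 0
    have "diag_mat (\<lambda>i. complex_of_real (e i ^ 0)) = mat 1" by (simp add: diag_mat_def mat_def vec_eq_iff)
    then show ?case using U by (simp add: unitary_mat_def)
  next
    case (Suc k)
    have D: "diag_mat (\<lambda>i. complex_of_real (e i)) ** diag_mat (\<lambda>i. complex_of_real (e i ^ k))
        = diag_mat (\<lambda>i. complex_of_real (e i ^ Suc k))"
      by (auto simp: vec_eq_iff diag_mat_mult) (auto simp: diag_mat_def)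
    have "((**) ?A ^^ Suc k) (mat 1) = U ** (diag_mat (\<lambda>i. complex_of_real (e i)) **
        (adjoint_mat U ** U) ** diag_mat (\<lambda>i. complex_of_real (e i ^ k))) ** adjoint_mat U"
      by (simp add: Suc matrix_mul_assoc)
    also have "diag_mat (\<lambda>i. complex_of_real (e i)) ** (adjoint_mat U ** U) **
        diag_mat (\<lambda>i. complex_of_real (e i ^ k)) = diag_mat (\<lambda>i. complex_of_real (e i ^ Suc k))"
      using U D by (simp add: unitary_mat_def)
    finally show ?case .
  qed
  show ?thesis
    unfolding mat_poly_def pow
    by (simp add: vec_eq_iff conjugate_diag_entry sum_distrib_left sum_distrib_right scaleR_sum_right)
      (subst sum.swap, simp add: scaleR_conv_of_real mult_ac)
qed

text \<open>Continuous functions \<open>g k\<close> that agree with \<open>t powr a\<close> from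
  some \<open>k\<close> on, at each fixed \<open>t\<close>, are approximated on
  \<open>{0..real k}\<close> to within \<open>1 / Suc k\<close> by the Weierstrass theorem. Only
  pointwise convergence is available, as the limit is discontinuous at zero for
  \<open>a \<le> 0\<close>.\<close>

lemma powr_pointwise_limit_polynomials:
  obtains c :: "nat \<Rightarrow> nat \<Rightarrow> real" and n
  where "\<And>t. 0 \<le> t \<Longrightarrow> (\<lambda>k. \<Sum>i\<le>n k. c k i * t ^ i) \<longlonglongrightarrow> t powr a"
proof -
  \<comment> \<open>The maximum removes the singularity at zero for negative \<open>a\<close>. The
    second factor forces the value \<open>0 powr a = 0\<close> at zero and equals one as soon as
    \<open>real k * t \<ge> 1\<close>.\<close>
  define g where "g k t = max t (1 / real (Suc k)) powr a * min 1 (real k * t)" for k t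
  have "continuous_on {0..real k} (g k)" for k
    unfolding g_def by (intro continuous_intros) (auto simp: max_def)
  then have "\<exists>q. real_polynomial_function q \<and> (\<forall>t\<in>{0..real k}. \<bar>g k t - q t\<bar> < 1 / real (Suc k))" for k
    using Stone_Weierstrass_real_polynomial_function[of "{0..real k}" "g k" "1 / real (Suc k)"]
    by (metis compact_Icc of_nat_0_less_iff zero_less_Suc zero_less_divide_1_iff)
  then have "\<exists>c n. \<forall>t\<in>{0..real k}. \<bar>g k t - (\<Sum>i\<le>n. c i * t ^ i)\<bar> < 1 / real (Suc k)" for k
    unfolding real_polynomial_function_iff_sum by metis
  then obtain c n where cn: "\<And>k t. t \<in> {0..real k} \<Longrightarrow> \<bar>g k t - (\<Sum>i\<le>n k. c k i * t ^ i)\<bar> < 1 / real (Suc k)"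
    by metis
  have "(\<lambda>k. \<Sum>i\<le>n k. c k i * t ^ i) \<longlonglongrightarrow> t powr a" if t: "0 \<le> t" for t
  proof -
    have "\<forall>\<^sub>F k in sequentially. g k t = t powr a"
    proof (cases "t = 0")
      case False
      then have "0 < t" using t by simp
      obtain N where N: "1 / t < real N" using reals_Archimedean2 by blast
      have "g k t = t powr a" if "N \<le> k" for k
      proof -
        have "1 / t < real k" using N that by (meson less_le_trans of_nat_le_iff)
        then have "1 \<le> real k * t" "1 / real (Suc k) \<le> t"
          using \<open>0 < t\<close> by (auto simp: field_simps)
        then show ?thesis by (simp add: g_def max_def min_def)
      qed
      then show ?thesis by (intro eventually_sequentiallyI[of N])
    qed (simp add: g_def)
    moreover have "\<forall>\<^sub>F k in sequentially. \<bar>g k t - (\<Sum>i\<le>n k. c k i * t ^ i)\<bar> < 1 / real (Suc k)"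
    proof -
      obtain N where "t \<le> real N" using real_arch_simple by blast
      then have "t \<in> {0..real k}" if "N \<le> k" for k using that t by (auto intro: order_trans)
      then show ?thesis by (intro eventually_sequentiallyI[of N] cn)
    qed
    ultimately have "\<forall>\<^sub>F k in sequentially. norm ((\<Sum>i\<le>n k. c k i * t ^ i) - t powr a) \<le> 1 / real (Suc k)"
      by eventually_elim (simp add: abs_minus_commute)
    then have "(\<lambda>k. (\<Sum>i\<le>n k. c k i * t ^ i) - t powr a) \<longlonglongrightarrow> 0"
      by (rule Lim_null_comparison) (use LIMSEQ_inverse_real_of_nat in \<open>simp add: inverse_eq_divide\<close>)
    then show ?thesis using LIM_zero_iff by blast
  qed
  then show thesis using that by blast
qed

lemma borel_measurable_mat_powr:
  assumes "W \<in> borel_measurable M" "\<And>x. nonneg_definite (W x)"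
  shows "(\<lambda>x. mat_powr (W x) a) \<in> borel_measurable M"
proof -
  obtain c n where lim: "\<And>t. 0 \<le> t \<Longrightarrow> (\<lambda>k. \<Sum>i\<le>n k. c k i * t ^ i) \<longlonglongrightarrow> t powr a"
    using powr_pointwise_limit_polynomials[of a] by metis
  show ?thesis
  proof (rule borel_measurable_LIMSEQ_metric)
    show "(\<lambda>x. mat_poly (c k) (n k) (W x)) \<in> borel_measurable M" for k
      by (intro borel_measurable_continuous_on[OF continuous_on_mat_poly] assms)
  next
    fix x
    obtain U e where U: "unitary_mat U" and e: "\<And>i. 0 \<le> e i"
      and A: "W x = U ** diag_mat (\<lambda>i. complex_of_real (e i)) ** adjoint_mat U"
      using spectral_theorem_nonneg_definite[OF assms(2)] by metis
    show "(\<lambda>k. mat_poly (c k) (n k) (W x)) \<longlonglongrightarrow> mat_powr (W x) a"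
      unfolding mat_powr_eq[OF U e A] unfolding A mat_poly_conjugate[OF U]
      by (intro vec_tendstoI) (simp only: conjugate_diag_entry, intro tendsto_intros tendsto_of_real lim e)
  qed
qed

lemma borel_measurable_op_norm [measurable]:
  "f \<in> borel_measurable M \<Longrightarrow> (\<lambda>x. op_norm (f x)) \<in> borel_measurable M"
  by (rule borel_measurable_continuous_on[OF continuous_on_op_norm])

lemma borel_measurable_mat_mult_const:
  "f \<in> borel_measurable M \<Longrightarrow> (\<lambda>x. f x ** B :: complex^'m^'m) \<in> borel_measurable M"
  by (rule borel_measurable_continuous_on[of "\<lambda>A. A ** B"])
    (auto simp: matrix_matrix_mult_def intro!: continuous_intros)

section \<open>Measurability and local integrability of matrix weights\<close>

lemma borel_measurable_vec:
  assumes "\<And>i. (\<lambda>x. f x $ i) \<in> borel_measurable M"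
  shows "(f :: 'a \<Rightarrow> ('b::euclidean_space)^'m) \<in> borel_measurable M"
proof (rule borel_measurable_euclidean_space[THEN iffD2], rule ballI)
  fix b :: "'b^'m" assume "b \<in> Basis"
  show "(\<lambda>x. f x \<bullet> b) \<in> borel_measurable M"
    unfolding inner_vec_def by (intro borel_measurable_sum borel_measurable_inner assms borel_measurable_const)
qed

text \<open>The truncations to the balls of radius \<open>k\<close> are integrable, hence
  measurable, and converge pointwise to \<open>f\<close>.\<close>

lemma locally_integrable_borel_measurable:
  fixes f :: "real^'n \<Rightarrow> complex"
  assumes "locally_integrable f"
  shows "f \<in> borel_measurable lebesgue"
proof (rule borel_measurable_LIMSEQ_metric)
  fix k :: nat
  have "set_integrable lebesgue (cball 0 (real k)) f"
    using assms by (simp add: locally_integrable_def)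
  then show "(\<lambda>x. indicat_real (cball 0 (real k)) x *\<^sub>R f x) \<in> borel_measurable lebesgue"
    unfolding set_integrable_def by (rule borel_measurable_integrable)
next
  fix x :: "real^'n"
  obtain N where N: "norm x \<le> real N" using real_arch_simple by blast
  have "\<forall>\<^sub>F k in sequentially. indicat_real (cball 0 (real k)) x *\<^sub>R f x = f x"
    using N by (intro eventually_sequentiallyI[of N]) (auto simp: indicator_def)
  then show "(\<lambda>k. indicat_real (cball 0 (real k)) x *\<^sub>R f x) \<longlonglongrightarrow> f x"
    by (rule tendsto_eventually)
qed

lemma matrix_weight_borel_measurable:
  assumes "matrix_weight W" shows "W \<in> borel_measurable lebesgue"
  using assms unfolding matrix_weight_def
  by (intro borel_measurable_vec locally_integrable_borel_measurable) auto

lemma matrix_weight_powr_measurable: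
  assumes "matrix_weight W" shows "(\<lambda>x. mat_powr (W x) a) \<in> borel_measurable lebesgue"
  using assms matrix_weight_borel_measurable borel_measurable_mat_powr unfolding matrix_weight_def by blast

text \<open>The operator norm is dominated by the sum of the moduli of all entries, each integrable
  on the compact closure of \<open>E\<close>.\<close>

lemma set_integrable_op_norm_weight:
  assumes W: "matrix_weight W" and "bounded E" "E \<in> sets lebesgue"
  shows "set_integrable lebesgue E (\<lambda>x. op_norm (W x) :: real)"
proof -
  have K: "compact (closure E)" using assms by (simp add: compact_closure)
  have "set_integrable lebesgue E (\<lambda>x. W x $ i $ j)" for i j
    using W K assms(3) unfolding matrix_weight_def locally_integrable_def
    by (meson closure_subset set_integrable_subset)
  then have int: "set_integrable lebesgue E (\<lambda>x. \<Sum>j\<in>UNIV. \<Sum>i\<in>UNIV. norm (W x $ i $ j))"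
    by (intro absolutely_integrable_sum set_integrable_norm finite)
  have bound: "norm (op_norm (W x)) \<le> (\<Sum>j\<in>UNIV. \<Sum>i\<in>UNIV. norm (W x $ i $ j))" for x
  proof -
    have "op_norm (W x) \<le> (\<Sum>j\<in>UNIV. norm (W x *v axis j 1))" by (rule op_norm_le_columns)
    also have "\<dots> \<le> (\<Sum>j\<in>UNIV. \<Sum>i\<in>UNIV. norm (W x $ i $ j))"
    proof (rule sum_mono)
      fix j
      show "norm (W x *v axis j 1) \<le> (\<Sum>i\<in>UNIV. norm (W x $ i $ j))"
        using L2_set_le_sum[of UNIV "\<lambda>i. norm (W x $ i $ j)"]
        by (simp add: norm_vec_def[of "W x *v axis j 1"] matrix_axis)
    qed
    finally show ?thesis by (simp add: op_norm_nonneg)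
  qed
  have "AE x in lebesgue. x \<in> E \<longrightarrow>
      norm (op_norm (W x)) \<le> norm (\<Sum>j\<in>UNIV. \<Sum>i\<in>UNIV. norm (W x $ i $ j))"
    by (intro AE_I2 impI) (unfold real_norm_def, rule order_trans[OF bound[unfolded real_norm_def] abs_ge_self])
  moreover have "set_borel_measurable lebesgue E (\<lambda>x. op_norm (W x))"
    unfolding set_borel_measurable_def
    using assms matrix_weight_borel_measurable[OF W]
    by (intro borel_measurable_scaleR borel_measurable_op_norm borel_measurable_indicator)
  ultimately show ?thesis by (intro set_integrable_bound[OF int])
qed


section \<open>Averages\<close>

text \<open>The sets over which averages behave well: on bounded measurable sets the weight is
  integrable, and positive measure makes the division meaningful.\<close>

definition averageable :: "(real^'n) set \<Rightarrow> bool" where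
  "averageable E \<longleftrightarrow> bounded E \<and> E \<in> sets lebesgue \<and> 0 < measure lebesgue E"

lemma averageable_lmeasurable: "averageable E \<Longrightarrow> E \<in> lmeasurable"
  by (auto simp: averageable_def intro: bounded_set_imp_lmeasurable)

lemma averageable_const:
  assumes "averageable E"
  shows "set_integrable lebesgue E (\<lambda>_. c::real)" "average E (\<lambda>_. c) = c"
proof -
  have E: "E \<in> sets lebesgue" "emeasure lebesgue E \<noteq> \<infinity>" "measure lebesgue E \<noteq> 0"
    using averageable_lmeasurable[OF assms] assms
    by (auto simp: fmeasurable_def averageable_def)
  show "set_integrable lebesgue E (\<lambda>_. c::real)"
    using E unfolding set_integrable_def by (auto simp: less_top)
  show "average E (\<lambda>_. c) = c"
    using E set_integral_const[of E lebesgue c] by (simp add: average_def)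
qed

lemma average_mono_AE:
  assumes "set_integrable lebesgue E f" "set_integrable lebesgue E g"
    "AE x in lebesgue. x \<in> E \<longrightarrow> f x \<le> g x"
  shows "average E f \<le> average E g"
  using set_integral_mono_AE[OF assms] unfolding average_def
  by (intro divide_right_mono) auto

lemma average_add:
  assumes "set_integrable lebesgue E f" "set_integrable lebesgue E g"
  shows "average E (\<lambda>x. f x + g x) = average E f + average E g"
  using assms by (simp add: average_def add_divide_distrib)

lemma average_cmult: "average E (\<lambda>x. c * f x) = c * average E f"
  by (simp add: average_def)

text \<open>If the integral vanished, \<open>f\<close> would be zero almost everywhere on
  \<open>E\<close>; being positive almost everywhere, this would make \<open>E\<close> a null
  set.\<close>

lemma average_pos:
  assumes E: "averageable E" and f: "set_integrable lebesgue E f"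
    and pos: "AE x in lebesgue. 0 < f x"
  shows "0 < average E f"
proof -
  have "emeasure lebesgue E \<noteq> 0"
    using E averageable_lmeasurable[OF E] by (auto simp: averageable_def measure_def)
  have nn: "AE x in lebesgue. 0 \<le> indicat_real E x *\<^sub>R f x"
    using pos by eventually_elim (simp add: indicator_def)
  have "(LINT x:E|lebesgue. f x) \<noteq> 0"
  proof
    assume "(LINT x:E|lebesgue. f x) = 0"
    then have "AE x in lebesgue. indicat_real E x *\<^sub>R f x = 0"
      using integral_nonneg_eq_0_iff_AE[OF f[unfolded set_integrable_def] nn]
      by (simp add: set_lebesgue_integral_def)
    with pos have "AE x in lebesgue. x \<notin> E"
      by eventually_elim (auto simp: indicator_def)
    then have "E \<in> null_sets lebesgue"
      using E AE_iff_null_sets[of E lebesgue] by (simp add: averageable_def)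
    then show False using \<open>emeasure lebesgue E \<noteq> 0\<close> by auto
  qed
  moreover have "0 \<le> (LINT x:E|lebesgue. f x)"
    using nn unfolding set_lebesgue_integral_def by (rule integral_nonneg_AE)
  ultimately show ?thesis using E by (simp add: average_def averageable_def)
qed

text \<open>Lets a cube with any choice of faces be replaced by the closed one.\<close>

lemma average_cong_set:
  assumes "E \<in> sets lebesgue" "E' \<in> sets lebesgue" "AE x in lebesgue. x \<in> E \<longleftrightarrow> x \<in> E'"
    and "f \<in> borel_measurable lebesgue"
  shows "average E f = average E' f"
proof -
  have "(LINT x:E|lebesgue. f x) = (LINT x:E'|lebesgue. f x)"
    using assms by (intro set_integral_cong_set) (auto simp: set_borel_measurable_def)
  moreover have "measure lebesgue E = measure lebesgue E'"
    using assms by (intro measure_eq_AE) auto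
  ultimately show ?thesis by (simp add: average_def)
qed

section \<open>Extended real averages expressed by real ones\<close>

lemma ext_average_cong_set:
  assumes "E \<in> sets lebesgue" "E' \<in> sets lebesgue" "AE x in lebesgue. x \<in> E \<longleftrightarrow> x \<in> E'"
  shows "ext_average E f = ext_average E' f"
proof -
  have *: "(\<integral>\<^sup>+x\<in>E. h x \<partial>lebesgue) = (\<integral>\<^sup>+x\<in>E'. h x \<partial>lebesgue)" for h
    by (rule nn_integral_cong_AE, rule AE_mp[OF assms(3)], rule AE_I2) (simp add: indicator_def)
  have "measure lebesgue E = measure lebesgue E'"
    using assms by (intro measure_eq_AE) auto
  then show ?thesis by (simp add: ext_average_def *)
qed

lemma ext_average_eq_average:
  assumes "averageable E" "set_integrable lebesgue E g"
  shows "ext_average E g = ereal (average E g)"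
proof -
  let ?f = "\<lambda>x. indicat_real E x *\<^sub>R g x"
  have f: "integrable lebesgue ?f" using assms(2) by (simp add: set_integrable_def)
  have eq: "(\<integral>\<^sup>+x\<in>E. ennreal (g x) \<partial>lebesgue) = (\<integral>\<^sup>+x. ennreal (?f x) \<partial>lebesgue)"
    "(\<integral>\<^sup>+x\<in>E. ennreal (- g x) \<partial>lebesgue) = (\<integral>\<^sup>+x. ennreal (- ?f x) \<partial>lebesgue)"
    by (auto intro!: nn_integral_cong simp: indicator_def)
  obtain a where a: "0 \<le> a" "(\<integral>\<^sup>+x. ennreal (?f x) \<partial>lebesgue) = ennreal a"
    using f unfolding real_integrable_def by (metis ennreal_cases infinity_ennreal_def)
  obtain b where b: "0 \<le> b" "(\<integral>\<^sup>+x. ennreal (- ?f x) \<partial>lebesgue) = ennreal b"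
    using f unfolding real_integrable_def by (metis ennreal_cases infinity_ennreal_def)
  have "(LINT x:E|lebesgue. g x) = a - b"
    unfolding set_lebesgue_integral_def real_lebesgue_integral_def[OF f] a(2) b(2)
    using a b by simp
  then show ?thesis
    using a(1) b(1) assms(1) unfolding ext_average_def eq a(2) b(2) average_def
    by (simp add: averageable_def)
qed

text \<open>Since \<open>\<infinity> - \<infinity> = \<infinity>\<close> in \<open>ereal\<close>, an
  average other than \<open>\<infinity>\<close> forces the positive part to have finite integral;
  the integrable minorant \<open>h\<close> controls the negative part.\<close>

lemma set_integrable_of_ext_average:
  assumes E: "averageable E" and "g \<in> borel_measurable lebesgue"
    and h: "set_integrable lebesgue E h" and le: "AE x in lebesgue. x \<in> E \<longrightarrow> h x \<le> g x"
    and fin: "ext_average E g \<noteq> \<infinity>"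
  shows "set_integrable lebesgue E g"
proof -
  let ?f = "\<lambda>x. indicat_real E x *\<^sub>R g x"
  have eq: "(\<integral>\<^sup>+x\<in>E. ennreal (g x) \<partial>lebesgue) = (\<integral>\<^sup>+x. ennreal (?f x) \<partial>lebesgue)"
    by (auto intro!: nn_integral_cong simp: indicator_def)
  have "(\<integral>\<^sup>+x. ennreal (?f x) \<partial>lebesgue) \<noteq> \<infinity>"
  proof
    assume "(\<integral>\<^sup>+x. ennreal (?f x) \<partial>lebesgue) = \<infinity>"
    then have "ext_average E g = \<infinity>"
      unfolding ext_average_def eq using E by (simp add: averageable_def)
    with fin show False by simp
  qed
  moreover have "(\<integral>\<^sup>+x. ennreal (- ?f x) \<partial>lebesgue) \<noteq> \<infinity>"
  proof -
    have "(\<integral>\<^sup>+x. ennreal (- ?f x) \<partial>lebesgue) \<le> (\<integral>\<^sup>+x. ennreal (- (indicat_real E x *\<^sub>R h x)) \<partial>lebesgue)"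
      by (rule nn_integral_mono_AE, rule AE_mp[OF le], rule AE_I2)
        (auto simp: indicator_def intro!: ennreal_leI)
    also have "\<dots> < \<infinity>"
      using h unfolding set_integrable_def real_integrable_def by (simp add: less_top)
    finally show ?thesis by simp
  qed
  ultimately show ?thesis
    using assms(2) E unfolding set_integrable_def real_integrable_def
    by (auto simp: averageable_def)
qed

lemma ext_exp_le_iff: "0 < C \<Longrightarrow> ext_exp z \<le> ereal C \<longleftrightarrow> z \<le> ereal (ln C)"
  by (cases z) (auto simp: ext_exp_def ln_ge_iff)

text \<open>Removes extended reals from the definitions of the classes: given an integrable
  minorant, a finite bound means integrability together with a real inequality.\<close>

lemma ext_exp_average_le_iff:
  assumes "averageable E" "g \<in> borel_measurable lebesgue"
    "set_integrable lebesgue E h" "AE x in lebesgue. x \<in> E \<longrightarrow> h x \<le> g x" "0 < C"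
  shows "ext_exp (ext_average E g) \<le> ereal C \<longleftrightarrow> set_integrable lebesgue E g \<and> average E g \<le> ln C"
proof
  assume "ext_exp (ext_average E g) \<le> ereal C"
  then have le: "ext_average E g \<le> ereal (ln C)" using assms(5) by (simp add: ext_exp_le_iff)
  then have "ext_average E g \<noteq> \<infinity>" by auto
  then have "set_integrable lebesgue E g" using set_integrable_of_ext_average assms by blast
  then show "set_integrable lebesgue E g \<and> average E g \<le> ln C"
    using le ext_average_eq_average[OF assms(1)] by simp
qed (use assms in \<open>simp add: ext_exp_le_iff ext_average_eq_average\<close>)

lemma average_mono_set:
  assumes E: "averageable E" and E': "averageable E'" and "E \<subseteq> E'" and f: "set_integrable lebesgue E' f"
    and nonneg: "AE x in lebesgue. 0 \<le> f x"
  shows "average E f \<le> measure lebesgue E' / measure lebesgue E * average E' f"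
proof -
  have "(LINT x:E|lebesgue. f x) \<le> (LINT x:E'|lebesgue. f x)"
    unfolding set_lebesgue_integral_def
  proof (rule integral_mono_AE)
    show "integrable lebesgue (\<lambda>x. indicat_real E x *\<^sub>R f x)"
      using set_integrable_subset[OF f] E \<open>E \<subseteq> E'\<close> by (simp add: averageable_def set_integrable_def)
    show "integrable lebesgue (\<lambda>x. indicat_real E' x *\<^sub>R f x)"
      using f by (simp add: set_integrable_def)
    show "AE x in lebesgue. indicat_real E x *\<^sub>R f x \<le> indicat_real E' x *\<^sub>R f x"
      using nonneg by eventually_elim (use \<open>E \<subseteq> E'\<close> in \<open>auto simp: indicator_def\<close>)
  qed
  then show ?thesis using E E' by (simp add: average_def averageable_def divide_right_mono)
qed

text \<open>Jensen's inequality in its tangent form \<open>ln (f / b) \<le> f / b - 1\<close>, with \<open>b\<close> the average of \<open>f\<close>.\<close>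

lemma le_exp_average_mult_average:
  assumes E: "averageable E" and g: "set_integrable lebesgue E g" and f: "set_integrable lebesgue E f"
    and L: "average E g \<le> L" and "0 < a"
    and pos: "AE x in lebesgue. 0 < f x" and le: "AE x in lebesgue. a \<le> exp (g x) * f x"
  shows "a \<le> exp L * average E f"
proof -
  define b where "b = average E f"
  have b: "0 < b" unfolding b_def by (rule average_pos[OF E f pos])
  note const = averageable_const[OF E]
  have fb: "set_integrable lebesgue E (\<lambda>x. 1 / b * f x)"
    using f by (intro set_integrable_mult_right)
  have "AE x in lebesgue. x \<in> E \<longrightarrow> ln a \<le> g x + (1 / b * f x + (ln b - 1))"
    using pos le
  proof eventually_elim
    case (elim x)
    have "ln a \<le> ln (exp (g x) * f x)" using elim \<open>0 < a\<close> by simp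
    also have "\<dots> = g x + ln b + ln (f x / b)" using elim b by (simp add: ln_mult ln_div)
    also have "\<dots> \<le> g x + ln b + (f x / b - 1)" using ln_le_minus_one[of "f x / b"] elim b by simp
    finally show ?case by simp
  qed
  then have "average E (\<lambda>_. ln a) \<le> average E (\<lambda>x. g x + (1 / b * f x + (ln b - 1)))"
    by (intro average_mono_AE const set_integral_add g fb)
  \<comment> \<open>The average of \<open>1 / b * f x\<close> is one and cancels the constant
    \<open>- 1\<close>.\<close>
  also have "\<dots> = average E g + ln b"
    using b average_add[OF g set_integral_add(1)[OF fb const(1)[of "ln b - 1"]]]
      average_add[OF fb const(1)[of "ln b - 1"]] average_cmult[of E "1 / b" f] const(2)[of "ln b - 1"]
    by (simp add: b_def[symmetric])
  finally have "ln a \<le> L + ln b" using L const by simp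
  then have "a \<le> exp (L + ln b)" using \<open>0 < a\<close> by (metis exp_le_cancel_iff exp_ln)
  then show ?thesis using b by (simp add: exp_add b_def)
qed


section \<open>Cubes\<close>

text \<open>A fixed representative for all cubes with given center and edge length, which differ
  from it by null sets.\<close>

definition ccube :: "real^'n \<Rightarrow> real \<Rightarrow> (real^'n) set" where
  "ccube c l = cbox (\<chi> i. c $ i - l/2) (\<chi> i. c $ i + l/2)"

lemma mem_ccube: "x \<in> ccube c l \<longleftrightarrow> (\<forall>i. \<bar>x $ i - c $ i\<bar> \<le> l/2)"
proof -
  have "(c $ i - l/2 \<le> x $ i \<and> x $ i \<le> c $ i + l/2) \<longleftrightarrow> \<bar>x $ i - c $ i\<bar> \<le> l/2" for i by linarith
  then show ?thesis by (simp add: ccube_def mem_box_cart)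
qed

lemma ccube_mono: "l \<le> l' \<Longrightarrow> ccube c l \<subseteq> ccube c l'"
  unfolding subset_iff mem_ccube by (meson divide_right_mono order_trans zero_le_numeral)

lemma measure_ccube:
  assumes "0 \<le> l" shows "measure lebesgue (ccube c l :: (real^'n) set) = l ^ CARD('n)"
proof -
  have "ccube c l \<noteq> {}" using assms mem_ccube[of c c l] by auto
  then show ?thesis unfolding ccube_def by (simp add: content_cbox_cart measure_completion)
qed

lemma averageable_ccube: "0 < l \<Longrightarrow> averageable (ccube c l)"
  using measure_ccube[of l c] by (auto simp: averageable_def ccube_def)

text \<open>\<open>Q\<close> lies between the open and the closed box, whose difference is
  negligible. Completeness of Lebesgue measure then also gives measurability of
  \<open>Q\<close>.\<close>

lemma is_cube_ccube:
  assumes "is_cube c l Q"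
  shows "0 < l" "Q \<in> sets lebesgue" "AE x in lebesgue. x \<in> Q \<longleftrightarrow> x \<in> ccube c l"
proof -
  obtain I where Q: "Q = {x. \<forall>i. x $ i \<in> I i}"
    and I: "\<And>i. {c $ i - l/2 <..< c $ i + l/2} \<subseteq> I i" "\<And>i. I i \<subseteq> {c $ i - l/2 .. c $ i + l/2}"
    using assms unfolding is_cube_def by blast
  show "0 < l" using assms by (simp add: is_cube_def)
  have sub: "Q \<subseteq> ccube c l"
    using I(2) by (fastforce simp: Q ccube_def mem_box_cart)
  have "ccube c l - Q \<subseteq> ccube c l - box (\<chi> i. c $ i - l/2) (\<chi> i. c $ i + l/2)"
    using I(1) by (fastforce simp: Q mem_box_cart)
  then have null: "ccube c l - Q \<in> null_sets lebesgue"
    using negligible_frontier_interval negligible_subset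
    unfolding negligible_iff_null_sets[symmetric] ccube_def by blast
  have "Q = ccube c l - (ccube c l - Q)" using sub by blast
  also have "\<dots> \<in> sets lebesgue"
    by (rule sets.Diff[OF _ null_setsD2[OF null]]) (simp add: ccube_def)
  finally show "Q \<in> sets lebesgue" .
  show "AE x in lebesgue. x \<in> Q \<longleftrightarrow> x \<in> ccube c l"
    using AE_not_in[OF null] by eventually_elim (use sub in auto)
qed

lemma is_cube_of_ccube: "0 < l \<Longrightarrow> is_cube c l (ccube c l)"
  unfolding is_cube_def
  by (intro conjI exI[of _ "\<lambda>i. {c $ i - l/2 .. c $ i + l/2}"]) (auto simp: ccube_def mem_box_cart)

text \<open>The dilation acts on each coordinate separately, so it maps the interval factors to
  interval factors and preserves their inclusions.\<close>

lemma is_cube_dilate: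
  assumes "is_cube c l Q" "0 < t" shows "is_cube c (t * l) (dilate c t Q)"
proof -
  obtain I where Q: "Q = {x. \<forall>i. x $ i \<in> I i}" and l: "0 < l"
    and I: "\<And>i. {c $ i - l/2 <..< c $ i + l/2} \<subseteq> I i" "\<And>i. I i \<subseteq> {c $ i - l/2 .. c $ i + l/2}"
    using assms unfolding is_cube_def by blast
  let ?J = "\<lambda>i. (\<lambda>s. c $ i + t * (s - c $ i)) ` I i"
  have "dilate c t Q = {x. \<forall>i. x $ i \<in> ?J i}"
  proof (intro equalityI subsetI CollectI)
    fix x assume "x \<in> {x. \<forall>i. x $ i \<in> ?J i}"
    then obtain s where s: "\<And>i. s i \<in> I i" "\<And>i. x $ i = c $ i + t * (s i - c $ i)"
      by (simp add: image_iff) metis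
    then have "x = c + t *\<^sub>R ((\<chi> i. s i) - c)" by (simp add: vec_eq_iff)
    moreover have "(\<chi> i. s i) \<in> Q" using s by (simp add: Q)
    ultimately show "x \<in> dilate c t Q" unfolding dilate_def by blast
  qed (auto simp: dilate_def Q)
  moreover have "{c $ i - t * l/2 <..< c $ i + t * l/2} \<subseteq> ?J i" for i
  proof
    fix s assume s: "s \<in> {c $ i - t * l/2 <..< c $ i + t * l/2}"
    have "c $ i + (s - c $ i) / t \<in> {c $ i - l/2 <..< c $ i + l/2}"
      using s \<open>0 < t\<close> by (simp add: field_simps)
    then have "c $ i + (s - c $ i) / t \<in> I i" using I(1) by blast
    then show "s \<in> ?J i"
      using \<open>0 < t\<close> by (intro image_eqI[of _ _ "c $ i + (s - c $ i) / t"]) simp_all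
  qed
  moreover have "?J i \<subseteq> {c $ i - t * l/2 .. c $ i + t * l/2}" for i
  proof
    fix r assume "r \<in> ?J i"
    then obtain s where s: "s \<in> I i" "r = c $ i + t * (s - c $ i)" by blast
    have "s \<in> {c $ i - l/2 .. c $ i + l/2}" using s(1) I(2) by blast
    then have "\<bar>s - c $ i\<bar> \<le> l/2" by (simp only: atLeastAtMost_iff) linarith
    then have "\<bar>t * (s - c $ i)\<bar> \<le> t * (l/2)" using \<open>0 < t\<close> by (simp add: abs_mult)
    then show "r \<in> {c $ i - t * l/2 .. c $ i + t * l/2}" using s by (auto simp: abs_le_iff)
  qed
  ultimately show ?thesis
    unfolding is_cube_def using l \<open>0 < t\<close> by (intro conjI exI[of _ ?J]) auto
qed


section \<open>The weighted averages\<close>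

lemma op_norm_mat_1: "op_norm (mat 1 :: complex^'m^'m) \<noteq> 0"
  using op_norm_mat[of 1, where 'm='m] by simp

context
  fixes W :: "real^'n \<Rightarrow> complex^'m^'m" and p :: real
  assumes W: "matrix_weight W" and p: "0 < p"
begin

definition weight_root where "weight_root x = mat_powr (W x) (1/p)"

definition inv_weight_root where "inv_weight_root x = mat_powr (W x) (-1/p)"

text \<open>The matrix \<open>B\<close> stays free: \<open>inv_weight_root y\<close> gives the
  integrand of \<open>weight_avg\<close>, and the identity gives a scalar weight used for lower
  bounds.\<close>

definition weight_density where "weight_density B x = op_norm (weight_root x ** B) powr p"

lemma weight_avg_density: "weight_avg p W E y = average E (weight_density (inv_weight_root y))"
  by (simp add: weight_avg_def weight_density_def[abs_def] weight_root_def inv_weight_root_def)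

lemma weight_nonneg: "nonneg_definite (W x)"
  using W by (simp add: matrix_weight_def)

lemma AE_weight_root_inverse:
  "AE x in lebesgue. inv_weight_root x ** weight_root x = mat 1 \<and> weight_root x ** inv_weight_root x = mat 1"
proof -
  have "AE x in lebesgue. invertible (W x)" using W by (simp add: matrix_weight_def)
  then show ?thesis
  proof eventually_elim
    case (elim x)
    then show ?case
      using mat_powr_inverse[OF weight_nonneg elim, of "1/p"] mat_powr_inverse[OF weight_nonneg elim, of "-1/p"]
      by (simp add: weight_root_def inv_weight_root_def)
  qed
qed

lemma weight_density_measurable: "weight_density B \<in> borel_measurable lebesgue"
  unfolding weight_density_def[abs_def] weight_root_def
  by (intro powr_real_measurable borel_measurable_op_norm borel_measurable_mat_mult_const
      matrix_weight_powr_measurable W borel_measurable_const)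

lemma weight_density_nonneg: "0 \<le> weight_density B x" by (simp add: weight_density_def)

lemma weight_density_bound: "weight_density B x \<le> op_norm B powr p * op_norm (W x)"
proof -
  have "weight_density B x \<le> (op_norm (weight_root x) * op_norm B) powr p"
    unfolding weight_density_def using p by (intro powr_mono2 op_norm_mult op_norm_nonneg) auto
  also have "\<dots> = op_norm (weight_root x) powr p * op_norm B powr p" by (simp add: powr_mult op_norm_nonneg)
  also have "\<dots> \<le> op_norm (W x) * op_norm B powr p"
    unfolding weight_root_def using op_norm_mat_powr_le[OF weight_nonneg p] by (intro mult_right_mono) auto
  finally show ?thesis by (simp add: mult.commute)
qed

lemma weight_density_integrable:
  assumes "averageable E" shows "set_integrable lebesgue E (weight_density B)"
proof -
  have E: "bounded E" "E \<in> sets lebesgue" using assms by (auto simp: averageable_def)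
  have "set_integrable lebesgue E (\<lambda>x. op_norm B powr p * op_norm (W x))"
    by (intro set_integrable_mult_right set_integrable_op_norm_weight[OF W E])
  moreover have "set_borel_measurable lebesgue E (weight_density B)"
    unfolding set_borel_measurable_def
    by (intro borel_measurable_scaleR weight_density_measurable borel_measurable_indicator E)
  moreover have "AE x in lebesgue. x \<in> E \<longrightarrow> norm (weight_density B x) \<le> norm (op_norm B powr p * op_norm (W x))"
    by (intro AE_I2 impI, unfold real_norm_def abs_of_nonneg[OF weight_density_nonneg])
      (rule order_trans[OF weight_density_bound abs_ge_self])
  ultimately show ?thesis by (rule set_integrable_bound)
qed

text \<open>Almost everywhere the root is invertible, so multiplying a matrix of nonzero norm by it
  cannot produce norm zero.\<close>

lemma weight_density_pos:
  assumes "op_norm B \<noteq> 0" shows "AE x in lebesgue. 0 < weight_density B x"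
  using AE_weight_root_inverse
proof eventually_elim
  case (elim x)
  have "op_norm B = op_norm (inv_weight_root x ** (weight_root x ** B))" using elim by (simp add: matrix_mul_assoc)
  then have "op_norm B \<le> op_norm (inv_weight_root x) * op_norm (weight_root x ** B)" using op_norm_mult by metis
  then have "op_norm (weight_root x ** B) \<noteq> 0" using assms op_norm_nonneg[of B] by auto
  then show ?case by (simp add: weight_density_def)
qed

lemma weight_density_zero: "op_norm B = 0 \<Longrightarrow> weight_density B x = 0"
  using weight_density_bound[of B x] weight_density_nonneg[of B x] by simp

lemma average_density_pos: "averageable E \<Longrightarrow> op_norm B \<noteq> 0 \<Longrightarrow> 0 < average E (weight_density B)"
  using average_pos weight_density_integrable weight_density_pos by blast

lemma average_density_nonneg: "0 \<le> average E (weight_density B)"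
  unfolding average_def set_lebesgue_integral_def
  by (intro divide_nonneg_nonneg integral_nonneg) (auto simp: weight_density_nonneg)

text \<open>Dominated convergence in \<open>B\<close>. Composition with the measurable map
  \<open>inv_weight_root\<close> then shows that \<open>weight_avg\<close> is measurable in
  \<open>y\<close>.\<close>

lemma continuous_on_average_density:
  assumes E: "averageable E"
  shows "continuous_on UNIV (\<lambda>B. average E (weight_density B))"
proof (rule continuous_on_sequentiallyI)
  fix u :: "nat \<Rightarrow> complex^'m^'m" and B assume u: "u \<longlonglongrightarrow> B"
  have cont: "continuous_on UNIV (\<lambda>B. weight_root x ** B)" for x
    by (auto simp: matrix_matrix_mult_def intro!: continuous_intros)
  have lim: "(\<lambda>k. weight_density (u k) x) \<longlonglongrightarrow> weight_density B x" for x
  proof -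
    have "(\<lambda>k. weight_root x ** u k) \<longlonglongrightarrow> weight_root x ** B"
      by (rule continuous_on_tendsto_compose[OF cont u]) auto
    then have "(\<lambda>k. op_norm (weight_root x ** u k)) \<longlonglongrightarrow> op_norm (weight_root x ** B)"
      by (rule continuous_on_tendsto_compose[OF continuous_on_op_norm[of UNIV]]) auto
    then show ?thesis unfolding weight_density_def
      using p by (intro tendsto_powr2 tendsto_const) (auto simp: op_norm_nonneg)
  qed
  \<comment> \<open>A convergent sequence has bounded norms, which turns
    \<open>weight_density_bound\<close> into a majorant that does not depend on
    \<open>k\<close>.\<close>
  have "(\<lambda>k. op_norm (u k)) \<longlonglongrightarrow> op_norm B"
    by (rule continuous_on_tendsto_compose[OF continuous_on_op_norm[of UNIV] u]) auto
  then have "Bseq (\<lambda>k. op_norm (u k))" by (intro convergent_imp_Bseq convergentI)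
  then obtain K where K: "0 < K" "\<And>k. norm (op_norm (u k)) \<le> K" by (rule BseqE) auto
  have bd: "norm (weight_density (u k) x) \<le> K powr p * op_norm (W x)" for k x
  proof -
    have "op_norm (u k) powr p \<le> K powr p"
      using K(2)[of k] p by (intro powr_mono2) (auto simp: op_norm_nonneg)
    then show ?thesis
      using weight_density_bound[of "u k" x] weight_density_nonneg[of "u k" x] op_norm_nonneg[of "W x"]
      by (simp add: order_trans mult_right_mono)
  qed
  have E': "bounded E" "E \<in> sets lebesgue" using E by (auto simp: averageable_def)
  have "(\<lambda>k. LINT x|lebesgue. indicat_real E x *\<^sub>R weight_density (u k) x) \<longlonglongrightarrow> (LINT x|lebesgue. indicat_real E x *\<^sub>R weight_density B x)"
  proof (rule integral_dominated_convergence)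
    show "integrable lebesgue (\<lambda>x. indicat_real E x *\<^sub>R (K powr p * op_norm (W x)))"
      using set_integrable_mult_right[OF set_integrable_op_norm_weight[OF W E']]
      unfolding set_integrable_def by blast
    show "AE x in lebesgue. norm (indicat_real E x *\<^sub>R weight_density (u k) x) \<le> indicat_real E x *\<^sub>R (K powr p * op_norm (W x))" for k
      using bd by (intro AE_I2) (simp add: indicator_def)
    show "AE x in lebesgue. (\<lambda>k. indicat_real E x *\<^sub>R weight_density (u k) x) \<longlonglongrightarrow> indicat_real E x *\<^sub>R weight_density B x"
      by (intro AE_I2 tendsto_intros lim)
  qed (intro borel_measurable_scaleR weight_density_measurable borel_measurable_indicator E')+
  then show "(\<lambda>k. average E (weight_density (u k))) \<longlonglongrightarrow> average E (weight_density B)"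
    unfolding average_def set_lebesgue_integral_def using E
    by (intro tendsto_divide tendsto_const) (auto simp: averageable_def)
qed

lemma weight_avg_measurable:
  assumes "averageable E"
  shows "weight_avg p W E \<in> borel_measurable lebesgue"
proof -
  have "weight_avg p W E = (\<lambda>y. average E (weight_density (inv_weight_root y)))" using weight_avg_density by blast
  also have "\<dots> \<in> borel_measurable lebesgue"
    unfolding inv_weight_root_def
    by (intro borel_measurable_continuous_on[OF continuous_on_average_density[OF assms]]
        matrix_weight_powr_measurable W)
  finally show ?thesis .
qed

text \<open>Write \<open>W(x)\<^sup>1\<^sup>/\<^sup>p B = (W(x)\<^sup>1\<^sup>/\<^sup>p W(y)\<^sup>-\<^sup>1\<^sup>/\<^sup>p) (W(y)\<^sup>1\<^sup>/\<^sup>p B)\<close>.\<close>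

lemma average_density_le:
  assumes E: "averageable E"
  shows "AE y in lebesgue. average E (weight_density B) \<le> weight_avg p W E y * weight_density B y"
  using AE_weight_root_inverse
proof eventually_elim
  case (elim y)
  have "weight_density B x \<le> weight_density B y * weight_density (inv_weight_root y) x" for x
  proof -
    have "weight_root x ** B = (weight_root x ** inv_weight_root y) ** (weight_root y ** B)"
      using elim by (metis matrix_mul_assoc matrix_mul_rid)
    then have "weight_density B x \<le> (op_norm (weight_root x ** inv_weight_root y) * op_norm (weight_root y ** B)) powr p"
      unfolding weight_density_def using p op_norm_mult op_norm_nonneg by (intro powr_mono2) auto
    also have "\<dots> = weight_density B y * weight_density (inv_weight_root y) x" by (simp add: weight_density_def powr_mult op_norm_nonneg)
    finally show ?thesis .
  qed
  then have "average E (weight_density B) \<le> average E (\<lambda>x. weight_density B y * weight_density (inv_weight_root y) x)"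
    using E by (intro average_mono_AE set_integrable_mult_right weight_density_integrable AE_I2) auto
  then show ?case by (simp add: average_cmult weight_avg_density mult.commute)
qed

text \<open>Take \<open>B\<close> to be the identity in \<open>average_density_le\<close>: the left
  side is positive, hence so is the factor \<open>weight_avg p W E y\<close>.\<close>

lemma weight_avg_pos:
  assumes E: "averageable E"
  shows "AE y in lebesgue. 0 < weight_avg p W E y"
  using average_density_le[OF E, of "mat 1"] weight_density_pos[OF op_norm_mat_1]
proof eventually_elim
  case (elim y)
  with average_density_pos[OF E op_norm_mat_1] have "0 < weight_avg p W E y * weight_density (mat 1) y" by linarith
  then show ?case using elim by (simp add: zero_less_mult_iff)
qed

text \<open>A lower bound for the logarithm whose average over \<open>E\<close> vanishes.\<close>

definition log_lower where "log_lower E y = 1 - 1 / average E (weight_density (mat 1)) * weight_density (mat 1) y"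

lemma log_lower_integrable:
  "averageable E' \<Longrightarrow> set_integrable lebesgue E' (log_lower E)"
  unfolding log_lower_def[abs_def]
  by (intro set_integral_diff averageable_const set_integrable_mult_right weight_density_integrable)

text \<open>With \<open>a\<close> the average and \<open>f\<close> the value of the identity
  density, \<open>average_density_le\<close> gives
  \<open>ln (weight_avg p W E y) \<ge> - ln (f / a)\<close>, and \<open>ln s \<le> s - 1\<close>
  finishes.\<close>

lemma log_lower_le:
  assumes E: "averageable E"
  shows "AE y in lebesgue. log_lower E y \<le> ln (weight_avg p W E y)"
  using average_density_le[OF E, of "mat 1"] weight_density_pos[OF op_norm_mat_1] weight_avg_pos[OF E]
proof eventually_elim
  case (elim y)
  define a where "a = average E (weight_density (mat 1))"
  have a: "0 < a" unfolding a_def by (rule average_density_pos[OF E op_norm_mat_1])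
  have "ln (weight_density (mat 1) y / a) \<le> weight_density (mat 1) y / a - 1" using elim a by (intro ln_le_minus_one) simp
  moreover have "ln a \<le> ln (weight_avg p W E y * weight_density (mat 1) y)"
    using elim a unfolding a_def by (subst ln_le_cancel_iff) auto
  ultimately show ?case
    using elim a by (simp add: log_lower_def a_def[symmetric] ln_mult ln_div)
qed

lemma ln_weight_avg_measurable:
  "averageable E \<Longrightarrow> (\<lambda>y. ln (weight_avg p W E y)) \<in> borel_measurable lebesgue"
  by (intro borel_measurable_ln weight_avg_measurable)

lemma ext_exp_average_weight_iff:
  assumes "averageable Q" "averageable E" "0 < C"
  shows "ext_exp (ext_average Q (\<lambda>y. ln (weight_avg p W E y))) \<le> ereal C \<longleftrightarrow>
    set_integrable lebesgue Q (\<lambda>y. ln (weight_avg p W E y)) \<and> average Q (\<lambda>y. ln (weight_avg p W E y)) \<le> ln C"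
proof -
  have "AE y in lebesgue. y \<in> Q \<longrightarrow> log_lower E y \<le> ln (weight_avg p W E y)"
    using log_lower_le[OF assms(2)] by eventually_elim simp
  then show ?thesis
    by (rule ext_exp_average_le_iff[OF assms(1) ln_weight_avg_measurable[OF assms(2)]
        log_lower_integrable[OF assms(1)] _ assms(3)])
qed

text \<open>An integrable upper bound suffices, since \<open>log_lower\<close> bounds the logarithm
  from below.\<close>

lemma ln_weight_avg_integrable:
  assumes Q: "averageable Q" and E: "averageable E" and g: "set_integrable lebesgue Q g"
    and le: "AE y in lebesgue. y \<in> Q \<longrightarrow> ln (weight_avg p W E y) \<le> g y"
  shows "set_integrable lebesgue Q (\<lambda>y. ln (weight_avg p W E y))"
proof (rule set_integrable_bound)
  show "set_integrable lebesgue Q (\<lambda>y. \<bar>g y\<bar> + \<bar>log_lower E y\<bar>)"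
    using set_integrable_norm[OF g] set_integrable_norm[OF log_lower_integrable[OF Q, of E]]
    by (intro set_integral_add) simp_all
  show "set_borel_measurable lebesgue Q (\<lambda>y. ln (weight_avg p W E y))"
    unfolding set_borel_measurable_def using Q
    by (intro borel_measurable_scaleR ln_weight_avg_measurable E borel_measurable_indicator)
      (simp add: averageable_def)
  show "AE y in lebesgue. y \<in> Q \<longrightarrow> norm (ln (weight_avg p W E y)) \<le> norm (\<bar>g y\<bar> + \<bar>log_lower E y\<bar>)"
    using le log_lower_le[OF E] by eventually_elim auto
qed

section \<open>Reduction of the classes to closed cubes\<close>

lemma weight_avg_cong_set:
  assumes "E \<in> sets lebesgue" "E' \<in> sets lebesgue" "AE x in lebesgue. x \<in> E \<longleftrightarrow> x \<in> E'"
  shows "weight_avg p W E = weight_avg p W E'"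
  unfolding weight_avg_density by (intro ext average_cong_set assms weight_density_measurable)

lemma weight_avg_is_cube: "is_cube c l Q \<Longrightarrow> weight_avg p W Q = weight_avg p W (ccube c l)"
  using is_cube_ccube[of c l Q] by (intro weight_avg_cong_set) (auto simp: ccube_def)

lemma ext_exp_cube_iff:
  assumes "is_cube c l Q" "is_cube c' l' R" "0 < C"
  shows "ext_exp (ext_average Q (\<lambda>y. ln (weight_avg p W R y))) \<le> ereal C \<longleftrightarrow>
    set_integrable lebesgue (ccube c l) (\<lambda>y. ln (weight_avg p W (ccube c' l') y)) \<and>
    average (ccube c l) (\<lambda>y. ln (weight_avg p W (ccube c' l') y)) \<le> ln C"
proof -
  have "ext_average Q h = ext_average (ccube c l) h" for h
    using is_cube_ccube[OF assms(1)] by (intro ext_average_cong_set) (auto simp: ccube_def)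
  then show ?thesis
    using is_cube_ccube(1)[OF assms(1)] is_cube_ccube(1)[OF assms(2)] assms(3)
    by (simp add: weight_avg_is_cube[OF assms(2)] ext_exp_average_weight_iff averageable_ccube)
qed

text \<open>Changing the faces of \<open>Q\<close>, or of its dilate, alters neither the outer
  average nor \<open>weight_avg\<close>, so closed cubes represent all of them.\<close>

lemma D_upper_iff:
  "W \<in> D_upper p d \<longleftrightarrow> (\<exists>C>0. \<forall>t\<ge>1. \<forall>c. \<forall>l>0.
    set_integrable lebesgue (ccube c l) (\<lambda>y. ln (weight_avg p W (ccube c (t * l)) y)) \<and>
    average (ccube c l) (\<lambda>y. ln (weight_avg p W (ccube c (t * l)) y)) \<le> ln (C * t powr d))"
    (is "_ \<longleftrightarrow> (\<exists>C>0. \<forall>t\<ge>1. \<forall>c. \<forall>l>0. ?B C t c l)")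
proof -
  have iff: "ext_exp (ext_average Q (\<lambda>y. ln (weight_avg p W (dilate c t Q) y))) \<le> ereal (C * t powr d)
      \<longleftrightarrow> ?B C t c l" if "is_cube c l Q" "1 \<le> t" "0 < C" for C t c l Q
    using that by (intro ext_exp_cube_iff is_cube_dilate) auto
  have eq: "(\<forall>t\<ge>1. \<forall>c l Q. is_cube c l Q \<longrightarrow>
      ext_exp (ext_average Q (\<lambda>y. ln (weight_avg p W (dilate c t Q) y))) \<le> ereal (C * t powr d))
    \<longleftrightarrow> (\<forall>t\<ge>1. \<forall>c. \<forall>l>0. ?B C t c l)" if "0 < C" for C
    using iff that is_cube_of_ccube is_cube_ccube(1) by meson
  show ?thesis
    unfolding D_upper_def mem_Collect_eq using W
    by (simp only: simp_thms) (intro ex_cong1 conj_cong refl eq)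
qed

text \<open>Finiteness of the supremum becomes a common bound \<open>K\<close>. In the converse
  direction the positive part is integrable because it is dominated by the modulus of the
  logarithm.\<close>

lemma Ap_inf_iff:
  "W \<in> Ap_inf p \<longleftrightarrow> (\<exists>K>0. \<forall>c. \<forall>l>0.
    set_integrable lebesgue (ccube c l) (\<lambda>y. ln (weight_avg p W (ccube c l) y)) \<and>
    average (ccube c l) (\<lambda>y. ln (weight_avg p W (ccube c l) y)) \<le> ln K)"
    (is "_ \<longleftrightarrow> (\<exists>K>0. \<forall>c. \<forall>l>0. ?B K c l)")
proof
  assume "W \<in> Ap_inf p"
  then have fin: "Ap_inf_const p W < \<infinity>" by (simp add: Ap_inf_def)
  \<comment> \<open>Taking the maximum with one keeps the bound positive, as required before passing
    to \<open>ln K\<close>.\<close>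
  obtain K where K: "0 < K" "Ap_inf_const p W \<le> ereal K"
  proof (cases "Ap_inf_const p W")
    case (real r)
    then show thesis by (intro that[of "max 1 r"]) auto
  next
    case MInf
    then show thesis by (intro that[of 1]) auto
  qed (use fin in auto)
  have "?B K c l" if "0 < l" for c l
  proof -
    have "ccube c l \<in> cubes" using is_cube_of_ccube[OF that] by (auto simp: cubes_def)
    then have "ext_exp (ext_average (ccube c l) (\<lambda>y. ln (weight_avg p W (ccube c l) y))) \<le> ereal K"
      using K(2) unfolding Ap_inf_const_def by (meson SUP_upper order_trans)
    then show ?thesis using K(1) that by (simp add: ext_exp_average_weight_iff averageable_ccube)
  qed
  then show "\<exists>K>0. \<forall>c. \<forall>l>0. ?B K c l" using K(1) by blast
next
  assume "\<exists>K>0. \<forall>c. \<forall>l>0. ?B K c l"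
  then obtain K where K: "0 < K" "\<And>c l. 0 < l \<Longrightarrow> ?B K c l" by blast
  have "Ap_inf_const p W \<le> ereal K"
    unfolding Ap_inf_const_def
  proof (rule SUP_least)
    fix Q :: "(real^'n) set" assume "Q \<in> cubes"
    then obtain c l where Q: "is_cube c l Q" by (auto simp: cubes_def)
    then show "ext_exp (ext_average Q (\<lambda>y. ln (weight_avg p W Q y))) \<le> ereal K"
      using ext_exp_cube_iff[OF Q Q K(1)] K(2) is_cube_ccube(1)[OF Q] by blast
  qed
  then have "Ap_inf_const p W < \<infinity>" by (rule le_less_trans) simp
  moreover have "set_integrable lebesgue Q (\<lambda>y. max 0 (ln (weight_avg p W Q y)))"
    if cube: "Q \<in> cubes" for Q
  proof -
    obtain c l where Q: "is_cube c l Q" using cube by (auto simp: cubes_def)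
    have meas: "(\<lambda>y. indicat_real A y *\<^sub>R max 0 (ln (weight_avg p W (ccube c l) y))) \<in> borel_measurable lebesgue"
      if "A \<in> sets lebesgue" for A
      by (intro borel_measurable_scaleR borel_measurable_indicator borel_measurable_max that
          ln_weight_avg_measurable averageable_ccube is_cube_ccube(1)[OF Q] borel_measurable_const)
    have l: "0 < l" by (rule is_cube_ccube(1)[OF Q])
    have int: "set_integrable lebesgue (ccube c l) (\<lambda>y. max 0 (ln (weight_avg p W (ccube c l) y)))"
      unfolding set_integrable_def
    proof (rule Bochner_Integration.integrable_bound)
      show "integrable lebesgue (\<lambda>y. indicat_real (ccube c l) y *\<^sub>R ln (weight_avg p W (ccube c l) y))"
        using K(2)[OF l, of c] by (simp add: set_integrable_def)
    qed (rule meas, simp add: ccube_def, intro AE_I2, simp add: indicator_def)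
    show ?thesis
      unfolding weight_avg_is_cube[OF Q]
      using int unfolding set_integrable_def
    proof (rule integrable_cong_AE_imp)
      show "(\<lambda>y. indicat_real Q y *\<^sub>R max 0 (ln (weight_avg p W (ccube c l) y))) \<in> borel_measurable lebesgue"
        by (rule meas[OF is_cube_ccube(2)[OF Q]])
      show "AE y in lebesgue. indicat_real (ccube c l) y *\<^sub>R max 0 (ln (weight_avg p W (ccube c l) y))
          = indicat_real Q y *\<^sub>R max 0 (ln (weight_avg p W (ccube c l) y))"
        using is_cube_ccube(3)[OF Q] by eventually_elim (simp add: indicator_def)
    qed
  qed
  ultimately show "W \<in> Ap_inf p" using W by (simp add: Ap_inf_def)
qed

end


section \<open>Upper dimensions\<close>

context
  fixes W :: "real^'n \<Rightarrow> complex^'m^'m" and p :: real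
  assumes W: "matrix_weight W" and p: "0 < p"
begin

text \<open>Jensen's inequality in the form \<open>le_exp_average_mult_average\<close>, applied to
  the constant \<open>average E (weight_density W p B)\<close>. If \<open>op_norm B = 0\<close>,
  both sides vanish.\<close>

lemma average_density_le_exp:
  assumes Q: "averageable Q" and E: "averageable E"
    and int: "set_integrable lebesgue Q (\<lambda>y. ln (weight_avg p W E y))"
    and L: "average Q (\<lambda>y. ln (weight_avg p W E y)) \<le> L"
  shows "average E (weight_density W p B) \<le> exp L * average Q (weight_density W p B)"
proof (cases "op_norm B = 0")
  case True
  then have "weight_density W p B = (\<lambda>_. 0)" using weight_density_zero[OF W p] by blast
  then show ?thesis by (simp add: average_def)
next
  case False
  show ?thesis
  proof (rule le_exp_average_mult_average[OF Q int weight_density_integrable[OF W p Q] L])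
    show "0 < average E (weight_density W p B)" by (rule average_density_pos[OF W p E False])
    show "AE x in lebesgue. 0 < weight_density W p B x" by (rule weight_density_pos[OF W p False])
    show "AE y in lebesgue. average E (weight_density W p B)
        \<le> exp (ln (weight_avg p W E y)) * weight_density W p B y"
      using average_density_le[OF W p E, of B] weight_avg_pos[OF W p E] by eventually_elim simp
  qed
qed

text \<open>The essential point is the quantifier order: the same \<open>C\<close> serves all
  matrices \<open>B\<close>, all cubes and all dilations.\<close>

lemma D_upper_average_density_le:
  assumes "W \<in> D_upper p d"
  obtains C where "0 < C" "\<And>t c l B. 1 \<le> t \<Longrightarrow> 0 < l \<Longrightarrow>
    average (ccube c (t * l)) (weight_density W p B) \<le> C * t powr d * average (ccube c l) (weight_density W p B)"
proof -
  obtain C where C: "0 < C" and D: "\<forall>t\<ge>1. \<forall>c. \<forall>l>0.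
    set_integrable lebesgue (ccube c l) (\<lambda>y. ln (weight_avg p W (ccube c (t * l)) y)) \<and>
    average (ccube c l) (\<lambda>y. ln (weight_avg p W (ccube c (t * l)) y)) \<le> ln (C * t powr d)"
    using assms unfolding D_upper_iff[OF W p] by (elim exE conjE)
  have "average (ccube c (t * l)) (weight_density W p B) \<le> C * t powr d * average (ccube c l) (weight_density W p B)"
    if "1 \<le> t" "0 < l" for t c l B
  proof -
    have "average (ccube c (t * l)) (weight_density W p B)
        \<le> exp (ln (C * t powr d)) * average (ccube c l) (weight_density W p B)"
      using D that by (intro average_density_le_exp averageable_ccube) auto
    then show ?thesis using C that by simp
  qed
  then show thesis by (rule that[OF C])
qed

text \<open>At a Lebesgue point of the density, its averages over small cubes stay bounded, whereas a
  negative upper dimension makes them blow up compared with a cube of fixed size.\<close>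

lemma D_upper_neg:
  assumes "d < 0" shows "W \<notin> D_upper p d"
proof
  assume "W \<in> D_upper p d"
  then obtain C where C: "0 < C" and le: "\<And>t c l B. 1 \<le> t \<Longrightarrow> 0 < l \<Longrightarrow>
    average (ccube c (t * l)) (weight_density W p B) \<le> C * t powr d * average (ccube c l) (weight_density W p B)"
    using D_upper_average_density_le by metis
  define f where "f = weight_density W p (mat 1)"
  have f_int: "set_integrable lebesgue (cbox a b) f" for a b
  proof -
    obtain r where r: "0 < r" "cbox a b \<subseteq> cball 0 r"
      using bounded_subset_ballD[OF bounded_cbox, of a b 0] ball_subset_cball by (metis subset_trans)
    have "\<bar>x $ i - 0 $ i\<bar> \<le> 2 * r / 2" if "x \<in> cball 0 r" for x :: "real^'n" and i
      using that component_le_norm_cart[of x i] by simp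
    then have "cball 0 r \<subseteq> (ccube 0 (2 * r) :: (real^'n) set)" by (auto simp only: mem_ccube)
    then have sub: "cbox a b \<subseteq> ccube 0 (2 * r)" using r by blast
    have int: "set_integrable lebesgue (ccube 0 (2 * r)) f"
      unfolding f_def using r by (intro weight_density_integrable[OF W p] averageable_ccube) simp
    show ?thesis by (rule set_integrable_subset[OF int _ sub]) simp
  qed
  then have "f integrable_on cbox a b" for a b by (rule set_lebesgue_integral_eq_integral(1))
  \<comment> \<open>The Lebesgue differentiation theorem along cubes that have \<open>x\<close> as
    their lower corner.\<close>
  then obtain Z where Z: "negligible Z" "\<And>x e. x \<notin> Z \<Longrightarrow> 0 < e \<Longrightarrow>
      \<exists>\<delta>>0. \<forall>h. 0 < h \<and> h < \<delta> \<longrightarrow> norm (integral (cbox x (x + h *\<^sub>R One)) f /\<^sub>R h ^ DIM(real^'n) - f x) < e"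
    by (rule integrable_ccontinuous_explicit) (rule that)
  obtain x where x: "x \<notin> Z" using Z(1) non_negligible_UNIV by (metis UNIV_eq_I)
  obtain \<delta> where \<delta>: "0 < \<delta>" and lim: "\<And>h. 0 < h \<Longrightarrow> h < \<delta> \<Longrightarrow>
      norm (integral (cbox x (x + h *\<^sub>R One)) f /\<^sub>R h ^ DIM(real^'n) - f x) < 1"
    using Z(2)[OF x zero_less_one] by blast
  \<comment> \<open>The center of the cube of edge \<open>h\<close> with lower corner
    \<open>x\<close>.\<close>
  define ctr where "ctr h = x + (\<chi> i. h / 2)" for h :: real
  have One: "(One :: real^'n) $ i = 1" for i
  proof -
    have axis: "(axis i 1 :: real^'n) \<in> Basis" by (simp add: axis_in_Basis_iff)
    have "(One :: real^'n) $ i = (\<Sum>b\<in>Basis. b \<bullet> (axis i 1 :: real^'n))"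
      by (simp only: cart_eq_inner_axis inner_sum_left)
    also have "\<dots> = (\<Sum>b\<in>Basis. if b = (axis i 1 :: real^'n) then 1 else 0)"
      using axis by (intro sum.cong refl) (rule inner_Basis)
    also have "\<dots> = 1" using axis by simp
    finally show ?thesis .
  qed
  then have One_eq: "(One :: real^'n) = (\<chi> i. 1)" by (simp only: vec_eq_iff vec_lambda_beta simp_thms)
  have small: "average (ccube (ctr h) h) f < f x + 1" if h: "0 < h" "h < \<delta>" for h
  proof -
    have box: "cbox x (x + h *\<^sub>R One) = ccube (ctr h) h"
      unfolding ccube_def One_eq by (rule arg_cong2[of _ _ _ _ cbox]) (simp_all add: vec_eq_iff ctr_def)
    have "integral (cbox x (x + h *\<^sub>R One)) f = (LINT y:ccube (ctr h) h|lebesgue. f y)"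
      unfolding box[symmetric] by (rule set_lebesgue_integral_eq_integral(2)[OF f_int, symmetric])
    then have "integral (cbox x (x + h *\<^sub>R One)) f /\<^sub>R h ^ DIM(real^'n) = average (ccube (ctr h) h) f"
      using h by (simp add: average_def measure_ccube divide_inverse mult.commute)
    then show ?thesis using lim[OF h] by simp
  qed
  \<comment> \<open>A positive quantity independent of \<open>h\<close>. For
    \<open>h \<le> 1/2\<close> the center \<open>ctr h\<close> differs from \<open>x\<close> by at
    most \<open>1/4\<close> in each coordinate, so this cube lies in every
    \<open>ccube (ctr h) 1\<close>.\<close>
  define \<eta> where "\<eta> = average (ccube x (1/2)) f"
  have "0 < \<eta>"
    unfolding \<eta>_def f_def
    by (intro average_density_pos[OF W p] averageable_ccube op_norm_mat_1) simp
  have fx: "0 \<le> f x" by (simp add: f_def weight_density_nonneg[OF W p])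
  have main: "\<eta> \<le> 2 ^ CARD('n) * C * (f x + 1) * h powr (- d)" if h: "0 < h" "h < \<delta>" "h \<le> 1/2" for h
  proof -
    have sub: "ccube x (1/2) \<subseteq> ccube (ctr h) 1"
    proof
      fix y assume "y \<in> ccube x (1/2)"
      then have y: "\<bar>y $ i - x $ i\<bar> \<le> (1/2)/2" for i by (simp only: mem_ccube)
      have "\<bar>y $ i - ctr h $ i\<bar> \<le> 1/2" for i
        using h(1,3) y[of i] unfolding ctr_def vector_add_component vec_lambda_beta by linarith
      then show "y \<in> ccube (ctr h) 1" unfolding mem_ccube by blast
    qed
    have int1: "set_integrable lebesgue (ccube (ctr h) 1) f" unfolding ccube_def by (rule f_int)
    have nn: "AE y in lebesgue. 0 \<le> f y"
      unfolding f_def by (intro AE_I2 weight_density_nonneg[OF W p])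
    have "\<eta> \<le> measure lebesgue (ccube (ctr h) 1) / measure lebesgue (ccube x (1/2)) * average (ccube (ctr h) 1) f"
      unfolding \<eta>_def by (rule average_mono_set[OF _ _ sub int1 nn]) (simp_all add: averageable_ccube)
    also have "\<dots> = 2 ^ CARD('n) * average (ccube (ctr h) 1) f"
      by (simp add: measure_ccube power_divide)
    \<comment> \<open>Dilation by \<open>1/h\<close> takes the cube of edge \<open>h\<close> to the
      unit cube with the same center.\<close>
    also have "average (ccube (ctr h) 1) f \<le> C * (1/h) powr d * average (ccube (ctr h) h) f"
      using le[of "1/h" h "ctr h" "mat 1"] h by (simp add: f_def)
    also have "\<dots> \<le> C * (1/h) powr d * (f x + 1)"
      using small[OF h(1,2)] C by (intro mult_left_mono) auto
    also have "(1/h) powr d = h powr (- d)" using h by (simp add: powr_minus powr_divide inverse_eq_divide)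
    finally show ?thesis by (simp add: mult_ac)
  qed
  \<comment> \<open>The estimate \<open>main\<close> says that \<open>h powr (- d)\<close> is at
    least \<open>\<kappa>\<close>; the choice of \<open>h\<close> below brings it down to
    \<open>\<kappa>/2\<close>.\<close>
  define \<kappa> where "\<kappa> = \<eta> / (2 ^ CARD('n) * C * (f x + 1))"
  have \<kappa>: "0 < \<kappa>" using \<open>0 < \<eta>\<close> C fx by (simp add: \<kappa>_def)
  define h where "h = min (min (\<delta>/2) (1/2)) ((\<kappa>/2) powr (1 / (- d)))"
  have h: "0 < h" "h < \<delta>" "h \<le> 1/2" using \<delta> \<kappa> by (auto simp: h_def)
  have "h powr (- d) \<le> ((\<kappa>/2) powr (1 / (- d))) powr (- d)"
    using h(1) assms by (intro powr_mono2) (auto simp: h_def)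
  also have "\<dots> = \<kappa>/2" using \<kappa> assms by (simp add: powr_powr)
  finally have "h powr (- d) < \<kappa>" using \<kappa> by simp
  then have "2 ^ CARD('n) * C * (f x + 1) * h powr (- d) < 2 ^ CARD('n) * C * (f x + 1) * \<kappa>"
    using C fx by (intro mult_strict_left_mono) auto
  also have "\<dots> = \<eta>" using C fx by (simp add: \<kappa>_def)
  finally show False using main[OF h] by simp
qed

section \<open>A-infinity as the union of the upper dimension classes\<close>

lemma D_upper_subset_Ap_inf:
  assumes "W \<in> D_upper p d" shows "W \<in> Ap_inf p"
proof -
  obtain C where C: "0 < C" and D: "\<forall>t\<ge>1. \<forall>c. \<forall>l>0.
    set_integrable lebesgue (ccube c l) (\<lambda>y. ln (weight_avg p W (ccube c (t * l)) y)) \<and>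
    average (ccube c l) (\<lambda>y. ln (weight_avg p W (ccube c (t * l)) y)) \<le> ln (C * t powr d)"
    using assms unfolding D_upper_iff[OF W p] by (elim exE conjE)
  \<comment> \<open>For \<open>t = 1\<close> the dilate is the cube itself and the power of
    \<open>t\<close> is one.\<close>
  from D[rule_format, of 1] show ?thesis
    unfolding Ap_inf_iff[OF W p] using C by (intro exI[of _ C]) simp
qed

lemma D_upper_mono:
  assumes "W \<in> D_upper p d" "d \<le> d'" shows "W \<in> D_upper p d'"
proof -
  obtain C where C: "0 < C" and D: "\<forall>t\<ge>1. \<forall>c. \<forall>l>0.
    set_integrable lebesgue (ccube c l) (\<lambda>y. ln (weight_avg p W (ccube c (t * l)) y)) \<and>
    average (ccube c l) (\<lambda>y. ln (weight_avg p W (ccube c (t * l)) y)) \<le> ln (C * t powr d)"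
    using assms unfolding D_upper_iff[OF W p] by (elim exE conjE)
  have le: "ln (C * t powr d) \<le> ln (C * t powr d')" if "1 \<le> t" for t
    using that C assms(2) by (subst ln_le_cancel_iff) (auto intro: powr_mono)
  show ?thesis
    unfolding D_upper_iff[OF W p]
    by (intro exI[of _ C] conjI allI impI C) (use D in blast, use D le order_trans in blast)
qed

text \<open>On the larger cube \<open>E\<close> the function \<open>h\<close> below is nonnegative, dominates the logarithm,
  and has average at most \<open>L + 1\<close>.\<close>

lemma average_density_double:
  assumes Q: "averageable Q" and E: "averageable E" and "Q \<subseteq> E"
    and int: "set_integrable lebesgue E (\<lambda>y. ln (weight_avg p W E y))"
    and L: "average E (\<lambda>y. ln (weight_avg p W E y)) \<le> L"
  shows "average E (weight_density W p B)
    \<le> exp (measure lebesgue E / measure lebesgue Q * (L + 1)) * average Q (weight_density W p B)"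
proof (rule average_density_le_exp[OF Q E])
  define g where "g y = ln (weight_avg p W E y)" for y
  define f where "f y = 1 - log_lower W p E y" for y
  define h where "h y = g y + f y" for y
  have g: "set_integrable lebesgue E g" unfolding g_def by (rule int)
  have f_eq: "f y = 1 / average E (weight_density W p (mat 1)) * weight_density W p (mat 1) y" for y
    by (simp add: f_def log_lower_def[OF W p])
  have f: "set_integrable lebesgue E f" "average E f = 1"
    using average_density_pos[OF W p E op_norm_mat_1]
    unfolding f_eq average_cmult
    by (auto intro!: set_integrable_mult_right weight_density_integrable[OF W p E])
  have h: "set_integrable lebesgue E h" unfolding h_def by (intro set_integral_add g f)
  have "0 \<le> f y" for y
    unfolding f_eq using average_density_nonneg[OF W p] weight_density_nonneg[OF W p] by simp
  then have gh: "g y \<le> h y" for y by (simp add: h_def)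
  have "average Q g \<le> average Q h"
    using gh set_integrable_subset[OF g] set_integrable_subset[OF h] Q \<open>Q \<subseteq> E\<close>
    by (intro average_mono_AE AE_I2) (auto simp: averageable_def)
  also have "\<dots> \<le> measure lebesgue E / measure lebesgue Q * average E h"
  proof (rule average_mono_set[OF Q E \<open>Q \<subseteq> E\<close> h])
    show "AE y in lebesgue. 0 \<le> h y"
      using log_lower_le[OF W p E] by eventually_elim (simp add: h_def f_def g_def)
  qed
  also have "\<dots> \<le> measure lebesgue E / measure lebesgue Q * (L + 1)"
    using average_add[OF g f(1)] f(2) L
    by (intro mult_left_mono) (simp_all add: h_def[abs_def] g_def[abs_def])
  finally show "average Q (\<lambda>y. ln (weight_avg p W E y)) \<le> measure lebesgue E / measure lebesgue Q * (L + 1)"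
    by (simp add: g_def[abs_def])
  show "set_integrable lebesgue Q (\<lambda>y. ln (weight_avg p W E y))"
    using set_integrable_subset[OF int] Q \<open>Q \<subseteq> E\<close> by (simp add: averageable_def)
qed

text \<open>A cube and its double have measure ratio \<open>2 ^ CARD('n)\<close>, so
  \<open>average_density_double\<close> gives one doubling constant for all \<open>B\<close>;
  induction on \<open>k\<close> iterates it.\<close>

lemma Ap_inf_doubling:
  assumes "W \<in> Ap_inf p"
  obtains D where "1 \<le> D" "\<And>c l B k. 0 < l \<Longrightarrow>
    average (ccube c (2 ^ k * l)) (weight_density W p B) \<le> D ^ k * average (ccube c l) (weight_density W p B)"
proof -
  obtain K where K: "0 < K" and A: "\<forall>c. \<forall>l>0.
    set_integrable lebesgue (ccube c l) (\<lambda>y. ln (weight_avg p W (ccube c l) y)) \<and>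
    average (ccube c l) (\<lambda>y. ln (weight_avg p W (ccube c l) y)) \<le> ln K"
    using assms unfolding Ap_inf_iff[OF W p] by (elim exE conjE)
  \<comment> \<open>The maximum with zero makes the exponent nonnegative, which ensures
    \<open>1 \<le> D\<close>.\<close>
  define D where "D = exp (2 ^ CARD('n) * (max 0 (ln K) + 1))"
  have "1 \<le> D" by (simp add: D_def)
  have double: "average (ccube c (2 * l)) (weight_density W p B) \<le> D * average (ccube c l) (weight_density W p B)"
    if "0 < l" for c l B
  proof -
    have "average (ccube c (2 * l)) (weight_density W p B) \<le>
      exp (measure lebesgue (ccube c (2 * l)) / measure lebesgue (ccube c l) * (max 0 (ln K) + 1)) *
      average (ccube c l) (weight_density W p B)"
      using that A[rule_format, of "2 * l" c]
      by (intro average_density_double averageable_ccube ccube_mono) auto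
    also have "measure lebesgue (ccube c (2 * l)) / measure lebesgue (ccube c l) = 2 ^ CARD('n)"
      using that by (simp add: measure_ccube power_mult_distrib)
    finally show ?thesis by (simp add: D_def)
  qed
  have "average (ccube c (2 ^ k * l)) (weight_density W p B) \<le> D ^ k * average (ccube c l) (weight_density W p B)"
    if l: "0 < l" for c l B k
  proof (induction k)
    case (Suc k)
    have "average (ccube c (2 ^ Suc k * l)) (weight_density W p B)
        \<le> D * average (ccube c (2 ^ k * l)) (weight_density W p B)"
      using double[of "2 ^ k * l" c B] l by (simp add: mult.assoc)
    also have "\<dots> \<le> D * (D ^ k * average (ccube c l) (weight_density W p B))"
      using \<open>1 \<le> D\<close> Suc by (intro mult_left_mono) auto
    finally show ?case by (simp add: mult.assoc)
  qed simp
  then show thesis by (rule that[OF \<open>1 \<le> D\<close>])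
qed

text \<open>Doubling bounds the weight average over the dilate by \<open>M * t powr d\<close> times
  that over the cube, for every \<open>y\<close>. Taking logarithms and averaging reduces the claim
  to the case without dilation, which is the hypothesis.\<close>

lemma Ap_inf_subset_D_upper:
  assumes "W \<in> Ap_inf p"
  shows "\<exists>d\<ge>0. W \<in> D_upper p d"
proof -
  obtain K where K: "0 < K" and A: "\<forall>c. \<forall>l>0.
    set_integrable lebesgue (ccube c l) (\<lambda>y. ln (weight_avg p W (ccube c l) y)) \<and>
    average (ccube c l) (\<lambda>y. ln (weight_avg p W (ccube c l) y)) \<le> ln K"
    using assms unfolding Ap_inf_iff[OF W p] by (elim exE conjE)
  obtain D where D: "1 \<le> D" and pow: "\<And>c l B k. 0 < l \<Longrightarrow>
    average (ccube c (2 ^ k * l)) (weight_density W p B) \<le> D ^ k * average (ccube c l) (weight_density W p B)"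
    using Ap_inf_doubling[OF assms] by metis
  \<comment> \<open>With this exponent, \<open>D powr log 2 t = t powr d\<close>.\<close>
  define d where "d = log 2 D"
  \<comment> \<open>The power of two pays for enlarging the dilate by \<open>t\<close> to that by
    \<open>2 ^ k\<close>, and \<open>D\<close> for rounding \<open>log 2 t\<close> up to
    \<open>k\<close>.\<close>
  define M where "M = 2 ^ CARD('n) * D"
  have M: "0 < M" using D by (simp add: M_def)
  have scaled: "weight_avg p W (ccube c (t * l)) y \<le> M * t powr d * weight_avg p W (ccube c l) y"
    if t: "1 \<le> t" and l: "0 < l" for t c l y
  proof -
    \<comment> \<open>The least number of doublings that covers the dilate; it satisfies
      \<open>t \<le> 2 ^ k \<le> 2 * t\<close>.\<close>
    define k where "k = nat \<lceil>log 2 t\<rceil>"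
    have log_nonneg: "0 \<le> log 2 t" using t by simp
    then have k: "log 2 t \<le> real k" "real k \<le> log 2 t + 1" unfolding k_def by linarith+
    have "2 powr log 2 t \<le> 2 powr real k" by (intro powr_mono k) simp
    then have k1: "t \<le> 2 ^ k" using t by (simp add: powr_realpow)
    have "2 powr real k \<le> 2 powr (log 2 t + 1)" by (intro powr_mono k) simp
    then have k2: "2 ^ k \<le> 2 * t" using t by (simp add: powr_realpow powr_add)
    have Dk: "D ^ k \<le> D * t powr d"
    proof -
      have "D ^ k = D powr real k" using D by (simp add: powr_realpow)
      also have "\<dots> \<le> D powr (log 2 t + 1)" using D k by (intro powr_mono) auto
      also have "\<dots> = D * D powr log 2 t" using D by (simp add: powr_add)
      also have "D powr log 2 t = t powr d"
        using D t by (simp add: powr_def d_def log_def)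
      finally show ?thesis .
    qed
    let ?f = "weight_density W p (inv_weight_root W p y)"
    have tl: "0 < t * l" "0 < 2 ^ k * l" using t l by simp_all
    have "average (ccube c (t * l)) ?f \<le> measure lebesgue (ccube c (2 ^ k * l)) / measure lebesgue (ccube c (t * l))
        * average (ccube c (2 ^ k * l)) ?f"
      using k1 l by (intro average_mono_set averageable_ccube tl ccube_mono weight_density_integrable[OF W p]
          AE_I2 weight_density_nonneg[OF W p] mult_right_mono) auto
    also have "\<dots> \<le> 2 ^ CARD('n) * average (ccube c (2 ^ k * l)) ?f"
    proof (intro mult_right_mono average_density_nonneg[OF W p])
      have "(2 ^ k * l) ^ CARD('n) \<le> (2 * (t * l)) ^ CARD('n)"
        using k2 l by (intro power_mono) auto
      then show "measure lebesgue (ccube c (2 ^ k * l)) / measure lebesgue (ccube c (t * l)) \<le> 2 ^ CARD('n)"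
        using zero_less_power[OF tl(1), of "CARD('n)"]
        by (simp only: measure_ccube[OF less_imp_le[OF tl(1)]] measure_ccube[OF less_imp_le[OF tl(2)]]
            pos_divide_le_eq power_mult_distrib[of 2 "t * l"])
    qed
    also have "\<dots> \<le> 2 ^ CARD('n) * (D ^ k * average (ccube c l) ?f)"
      by (intro mult_left_mono pow l) simp
    also have "\<dots> \<le> 2 ^ CARD('n) * ((D * t powr d) * average (ccube c l) ?f)"
      by (intro mult_left_mono mult_right_mono Dk average_density_nonneg[OF W p]) simp
    finally show ?thesis by (simp add: weight_avg_density[OF W p] M_def mult_ac)
  qed
  have "set_integrable lebesgue (ccube c l) (\<lambda>y. ln (weight_avg p W (ccube c (t * l)) y)) \<and>
    average (ccube c l) (\<lambda>y. ln (weight_avg p W (ccube c (t * l)) y)) \<le> ln (K * M * t powr d)"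
    if t: "1 \<le> t" and l: "0 < l" for t c l
  proof -
    have Q: "averageable (ccube c l)" and E: "averageable (ccube c (t * l))"
      using t l by (simp_all add: averageable_ccube)
    have A': "set_integrable lebesgue (ccube c l) (\<lambda>y. ln (weight_avg p W (ccube c l) y))"
      "average (ccube c l) (\<lambda>y. ln (weight_avg p W (ccube c l) y)) \<le> ln K"
      using A l by auto
    have int: "set_integrable lebesgue (ccube c l) (\<lambda>y. ln (M * t powr d) + ln (weight_avg p W (ccube c l) y))"
      by (intro set_integral_add averageable_const Q A')
    have le: "AE y in lebesgue. y \<in> ccube c l \<longrightarrow> ln (weight_avg p W (ccube c (t * l)) y)
        \<le> ln (M * t powr d) + ln (weight_avg p W (ccube c l) y)"
      using weight_avg_pos[OF W p Q] weight_avg_pos[OF W p E]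
    proof eventually_elim
      case (elim y)
      have "ln (weight_avg p W (ccube c (t * l)) y) \<le> ln (M * t powr d * weight_avg p W (ccube c l) y)"
        using scaled[OF t l] elim by (rule_tac ln_mono) auto
      also have "\<dots> = ln (M * t powr d) + ln (weight_avg p W (ccube c l) y)"
        using elim M t by (subst ln_mult) auto
      finally show ?case by simp
    qed
    have int': "set_integrable lebesgue (ccube c l) (\<lambda>y. ln (weight_avg p W (ccube c (t * l)) y))"
      by (rule ln_weight_avg_integrable[OF W p Q E int le])
    have "average (ccube c l) (\<lambda>y. ln (weight_avg p W (ccube c (t * l)) y)) \<le> ln (M * t powr d) + ln K"
      using average_mono_AE[OF int' int le] average_add[OF averageable_const(1)[OF Q] A'(1), of "ln (M * t powr d)"]
        averageable_const(2)[OF Q] A'(2) by simp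
    also have "\<dots> = ln (K * M * t powr d)" using K M t by (simp add: ln_mult)
    finally show ?thesis using int' by simp
  qed
  then have "W \<in> D_upper p d"
    unfolding D_upper_iff[OF W p] using K M by (intro exI[of _ "K * M"]) auto
  moreover have "0 \<le> d" using D by (simp add: d_def)
  ultimately show ?thesis by blast
qed

text \<open>The essential supremum bound on the dilated cube holds almost everywhere on the smaller
  cube inside it, with a constant independent of \<open>t\<close>.\<close>

lemma Ap_subset_D_upper_0:
  assumes "W \<in> Ap p" shows "W \<in> D_upper p 0"
proof -
  let ?S = "SUP Q\<in>cubes. esssup (lebesgue_on Q) (\<lambda>y. ereal (weight_avg p W Q y))"
  have fin: "?S < \<infinity>" using assms by (simp add: Ap_def)
  obtain K where K: "1 \<le> K" "?S \<le> ereal K"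
  proof (cases ?S)
    case (real r)
    then show thesis by (intro that[of "max 1 r"]) auto
  next
    case MInf
    then show thesis by (intro that[of 1]) auto
  qed (use fin in auto)
  have "set_integrable lebesgue (ccube c l) (\<lambda>y. ln (weight_avg p W (ccube c (t * l)) y)) \<and>
    average (ccube c l) (\<lambda>y. ln (weight_avg p W (ccube c (t * l)) y)) \<le> ln (K * t powr 0)"
    if t: "1 \<le> t" and l: "0 < l" for t c l
  proof -
    let ?E = "ccube c (t * l)"
    have Q: "averageable (ccube c l)" and E: "averageable ?E"
      using t l by (simp_all add: averageable_ccube)
    have "?E \<in> cubes" using is_cube_of_ccube[of "t * l" c] t l unfolding cubes_def by auto
    then have "esssup (lebesgue_on ?E) (\<lambda>y. ereal (weight_avg p W ?E y)) \<le> ereal K"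
      using K(2) by (meson SUP_upper order_trans)
    then have "AE y in lebesgue_on ?E. weight_avg p W ?E y \<le> K"
      using esssup_AE[of "\<lambda>y. ereal (weight_avg p W ?E y)" "lebesgue_on ?E"]
      by (auto elim!: eventually_mono dest: order_trans)
    then have "AE y in lebesgue. y \<in> ?E \<longrightarrow> weight_avg p W ?E y \<le> K"
      by (subst (asm) AE_restrict_space_iff) (simp_all add: ccube_def)
    then have le: "AE y in lebesgue. y \<in> ccube c l \<longrightarrow> ln (weight_avg p W ?E y) \<le> ln K"
      using weight_avg_pos[OF W p E]
    proof eventually_elim
      case (elim y)
      have "ccube c l \<subseteq> ?E" using t l by (intro ccube_mono) simp
      then show ?case using elim K(1) by (auto intro!: ln_mono)
    qed
    note int = averageable_const(1)[OF Q, of "ln K"]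
    have int': "set_integrable lebesgue (ccube c l) (\<lambda>y. ln (weight_avg p W ?E y))"
      by (rule ln_weight_avg_integrable[OF W p Q E int le])
    show ?thesis
      using int' average_mono_AE[OF int' int le] averageable_const(2)[OF Q] t by simp
  qed
  then show ?thesis
    unfolding D_upper_iff[OF W p] using K(1) by (intro exI[of _ K]) auto
qed

end


section \<open>Power weights\<close>

lemma mat_of_real_mult_vec: "(mat (complex_of_real s) :: complex^'m^'m) *v z = complex_of_real s *s z"
  by (simp add: vec_eq_iff mat_def matrix_vector_mult_def if_distrib if_distribR cong: if_cong)

lemma mat_of_real_mult:
  "(mat (complex_of_real s) :: complex^'m^'m) ** mat (complex_of_real r) = mat (complex_of_real (s * r))"
proof -
  have "((mat (complex_of_real s) :: complex^'m^'m) ** mat (complex_of_real r)) *v z = mat (complex_of_real (s * r)) *v z" for z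
    unfolding matrix_vector_mul_assoc[symmetric] mat_of_real_mult_vec vector_smult_assoc by simp
  then show ?thesis unfolding matrix_eq by blast
qed

text \<open>A scalar matrix is already diagonal, so the identity serves as its unitary
  matrix.\<close>

lemma mat_powr_mat:
  assumes "0 \<le> s"
  shows "mat_powr (mat (complex_of_real s) :: complex^'m^'m) b = mat (complex_of_real (s powr b))"
proof -
  have adj: "adjoint_mat (mat 1) = (mat 1 :: complex^'m^'m)"
    by (simp add: adjoint_mat_def vec_eq_iff mat_def transpose_def)
  have diag: "diag_mat (\<lambda>_. c) = (mat c :: complex^'m^'m)" for c by (simp add: diag_mat_def mat_def)
  have "unitary_mat (mat 1 :: complex^'m^'m)" by (simp add: unitary_mat_def adj)
  then show ?thesis
    using mat_powr_eq[of "mat 1" "\<lambda>_. s" "mat (complex_of_real s) :: complex^'m^'m" b] assms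
    by (simp add: adj diag)
qed

text \<open>At the origin the value is the zero matrix, as \<open>0 powr a = 0\<close>; everywhere
  else it is invertible.\<close>

definition power_weight :: "real \<Rightarrow> real^'n \<Rightarrow> complex^'m^'m" where
  "power_weight a x = mat (complex_of_real (norm x powr a))"

lemma AE_nonzero: "AE x::real^'n in lebesgue. x \<noteq> 0"
proof -
  have "{0} \<in> null_sets (lebesgue :: (real^'n) measure)"
    unfolding negligible_iff_null_sets[symmetric] by simp
  then show ?thesis using AE_not_in by fastforce
qed

lemma continuous_on_norm_powr:
  assumes "0 < a" shows "continuous_on S (\<lambda>x::'a::real_normed_vector. norm x powr a)"
  using assms by (intro continuous_on_powr' continuous_intros) auto

text \<open>For positive \<open>a\<close> the entries are continuous, hence locally integrable, and
  off the origin the inverse is the scalar matrix with the opposite exponent.\<close>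

lemma matrix_weight_power_weight:
  assumes "0 < a"
  shows "matrix_weight (power_weight a :: real^'n \<Rightarrow> complex^'m^'m)"
  unfolding matrix_weight_def
proof (intro conjI allI)
  fix x :: "real^'n"
  show "nonneg_definite (power_weight a x :: complex^'m^'m)"
    unfolding nonneg_definite_iff_cip power_weight_def mat_of_real_mult_vec cip_simps cip_self
    by (simp flip: of_real_mult)
next
  show "AE x::real^'n in lebesgue. invertible (power_weight a x :: complex^'m^'m)"
    using AE_nonzero
  proof eventually_elim
    case (elim x)
    have "(power_weight a x :: complex^'m^'m) ** mat (complex_of_real (norm x powr (- a))) = mat 1"
      "mat (complex_of_real (norm x powr (- a))) ** (power_weight a x :: complex^'m^'m) = mat 1"
      using elim unfolding power_weight_def mat_of_real_mult powr_add[symmetric] by simp_all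
    then show ?case unfolding invertible_def by blast
  qed
next
  fix i j :: 'm
  have cont: "continuous_on S (\<lambda>x. (power_weight a x :: complex^'m^'m) $ i $ j)" for S :: "(real^'n) set"
    unfolding power_weight_def mat_def
    by (cases "i = j") (auto intro!: continuous_on_of_real continuous_on_norm_powr assms)
  show "locally_integrable (\<lambda>x::real^'n. (power_weight a x :: complex^'m^'m) $ i $ j)"
    unfolding locally_integrable_def
  proof (intro allI impI)
    fix K :: "(real^'n) set" assume "compact K"
    obtain u where u: "K \<subseteq> cbox (- u) u"
      by (rule bounded_subset_cbox_symmetric[OF compact_imp_bounded[OF \<open>compact K\<close>]])
    have "K \<in> sets lebesgue" using \<open>compact K\<close> by (simp add: borel_compact)
    then show "(\<lambda>x. (power_weight a x :: complex^'m^'m) $ i $ j) absolutely_integrable_on K"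
      by (rule set_integrable_subset[OF absolutely_integrable_continuous[OF cont] _ u])
  qed
qed

text \<open>The norm of a product of scalar matrices is a product of numbers, so the roots and the
  power \<open>p\<close> cancel and the dependence on \<open>y\<close> factors out.\<close>

lemma weight_avg_power_weight:
  assumes "0 < p"
  shows "weight_avg p (power_weight a :: real^'n \<Rightarrow> complex^'m^'m) E y
    = average E (\<lambda>x. norm x powr a) * norm y powr (- a)"
proof -
  have "op_norm (mat_powr (power_weight a x :: complex^'m^'m) (1/p) ** mat_powr (power_weight a y) (-1/p)) powr p
      = norm y powr (- a) * norm x powr a" for x :: "real^'n"
  proof -
    have "op_norm (mat_powr (power_weight a x :: complex^'m^'m) (1/p) ** mat_powr (power_weight a y) (-1/p))
      = norm x powr (a/p) * norm y powr (- a/p)"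
      unfolding power_weight_def
      by (simp add: mat_powr_mat mat_of_real_mult op_norm_mat powr_powr del: of_real_mult)
    then show ?thesis using assms by (simp add: powr_mult powr_powr)
  qed
  then show ?thesis unfolding weight_avg_def by (simp only: average_cmult) (rule mult.commute)
qed

section \<open>Sharpness of the exponent of a power weight\<close>

lemma norm_le_ccube:
  assumes "x \<in> (ccube c l :: (real^'n) set)"
  shows "norm (x - c) \<le> real CARD('n) * (l/2)"
proof -
  have "norm (x - c) \<le> (\<Sum>i\<in>UNIV. \<bar>(x - c) $ i\<bar>)" by (rule norm_le_l1_cart)
  also have "\<dots> \<le> (\<Sum>i\<in>(UNIV::'n set). l/2)" using assms by (intro sum_mono) (simp add: mem_ccube)
  finally show ?thesis by simp
qed

lemma norm_powr_integrable:
  assumes "0 < a" shows "set_integrable lebesgue (ccube c l) (\<lambda>x. norm x powr a)"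
  unfolding ccube_def by (intro absolutely_integrable_continuous continuous_on_norm_powr assms)

lemma average_norm_powr_pos:
  assumes "0 < a" "0 < l"
  shows "0 < average (ccube c l :: (real^'n) set) (\<lambda>x. norm x powr a)"
proof (rule average_pos[OF averageable_ccube[OF assms(2)] norm_powr_integrable[OF assms(1)]])
  show "AE x::real^'n in lebesgue. 0 < norm x powr a" using AE_nonzero by eventually_elim simp
qed

text \<open>Take \<open>\<lambda>Q\<close> to be the fixed unit cube and let \<open>Q\<close> shrink to the origin.\<close>

lemma power_weight_not_D_upper:
  assumes p: "0 < p" and a: "0 < a" and d: "d < a"
  shows "(power_weight a :: real^'n \<Rightarrow> complex^'m^'m) \<notin> D_upper p d"
proof
  let ?W = "power_weight a :: real^'n \<Rightarrow> complex^'m^'m"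
  let ?n = "real CARD('n)"
  assume "?W \<in> D_upper p d"
  then obtain C where C: "0 < C" and D: "\<forall>t\<ge>1. \<forall>c. \<forall>l>0.
    set_integrable lebesgue (ccube c l) (\<lambda>y. ln (weight_avg p ?W (ccube c (t * l)) y)) \<and>
    average (ccube c l) (\<lambda>y. ln (weight_avg p ?W (ccube c (t * l)) y)) \<le> ln (C * t powr d)"
    unfolding D_upper_iff[OF matrix_weight_power_weight[OF a] p] by (elim exE conjE)
  define A where "A = average (ccube 0 1 :: (real^'n) set) (\<lambda>x. norm x powr a)"
  have A: "0 < A" unfolding A_def by (rule average_norm_powr_pos[OF a]) simp
  have n: "1 \<le> ?n" by (simp add: Suc_le_eq)
  \<comment> \<open>On the cube of edge \<open>l\<close> the norm is at most \<open>?n * l\<close>,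
    so the weight average over the unit cube is at least \<open>A * (?n * l) powr (- a)\<close>. The
    assumed dimension, with \<open>t = 1/l\<close>, bounds its geometric mean by
    \<open>C * (1/l) powr d\<close>.\<close>
  have bound: "A \<le> C * ?n powr a * l powr (a - d)" if l: "0 < l" "l \<le> 1" for l
  proof -
    let ?g = "\<lambda>y. ln (weight_avg p ?W (ccube 0 1) y)"
    have Q: "averageable (ccube 0 l :: (real^'n) set)" using l by (simp add: averageable_ccube)
    have int: "set_integrable lebesgue (ccube 0 l) ?g" and avg: "average (ccube 0 l) ?g \<le> ln (C * (1/l) powr d)"
      using D[rule_format, of "1/l" l 0] l by simp_all
    have "AE y in lebesgue. y \<in> ccube 0 l \<longrightarrow> ln (A * (?n * l) powr (- a)) \<le> ?g y"
      using AE_nonzero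
    proof eventually_elim
      case (elim y)
      show ?case
      proof
        assume "y \<in> ccube 0 l"
        then have "norm y \<le> ?n * (l/2)" using norm_le_ccube[of y 0 l] by simp
        also have "\<dots> \<le> ?n * l" using l by simp
        finally have "(?n * l) powr (- a) \<le> norm y powr (- a)"
          using elim a by (intro powr_mono2') auto
        then show "ln (A * (?n * l) powr (- a)) \<le> ?g y"
          unfolding weight_avg_power_weight[OF p] A_def[symmetric]
          using A l n by (intro ln_mono mult_left_mono mult_pos_pos) auto
      qed
    qed
    then have "average (ccube 0 l) (\<lambda>_::real^'n. ln (A * (?n * l) powr (- a))) \<le> average (ccube 0 l) ?g"
      by (rule average_mono_AE[OF averageable_const(1)[OF Q] int])
    then have "ln (A * (?n * l) powr (- a)) \<le> average (ccube 0 l) ?g"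
      by (simp only: averageable_const(2)[OF Q])
    then have "ln (A * (?n * l) powr (- a)) \<le> ln (C * (1/l) powr d)" using avg by linarith
    then have "A * (?n * l) powr (- a) \<le> C * (1/l) powr d"
      using A C l n by (subst (asm) ln_le_cancel_iff) auto
    then have "A * (?n * l) powr (- a) * (?n * l) powr a \<le> C * (1/l) powr d * (?n * l) powr a"
      by (intro mult_right_mono) auto
    moreover have "(?n * l) powr (- a) * (?n * l) powr a = 1" using l n by (simp flip: powr_add)
    moreover have "(1/l) powr d * (?n * l) powr a = ?n powr a * l powr (a - d)"
      using l n by (simp add: powr_mult powr_divide powr_diff)
    ultimately show ?thesis by (simp add: mult.assoc)
  qed
  define \<kappa> where "\<kappa> = A / (C * ?n powr a)"
  have \<kappa>: "0 < \<kappa>" using A C n by (simp add: \<kappa>_def)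
  \<comment> \<open>Small enough that \<open>l powr (a - d) \<le> \<kappa>/2\<close>, against the
    lower bound \<open>\<kappa>\<close> that \<open>bound\<close> would give.\<close>
  define l where "l = min 1 ((\<kappa>/2) powr (1 / (a - d)))"
  have l: "0 < l" "l \<le> 1" using \<kappa> by (auto simp: l_def)
  have "l powr (a - d) \<le> ((\<kappa>/2) powr (1 / (a - d))) powr (a - d)"
    using l(1) d by (intro powr_mono2) (auto simp: l_def)
  also have "\<dots> = \<kappa>/2" using \<kappa> d by (simp add: powr_powr)
  finally have "l powr (a - d) < \<kappa>" using \<kappa> by simp
  then have "C * ?n powr a * l powr (a - d) < C * ?n powr a * \<kappa>"
    using C n by (intro mult_strict_left_mono) auto
  also have "\<dots> = A" using C n by (simp add: \<kappa>_def)
  finally show False using bound[OF l] by simp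
qed

text \<open>The integrand is at most the number of \<open>k\<close> with \<open>\<parallel>y\<parallel> \<le> r / 2\<^sup>k\<close>.\<close>

lemma log_singularity:
  assumes r: "0 < r"
  defines "h \<equiv> \<lambda>y::real^'n. max 0 (ln (r / norm y))"
  shows "integrable lebesgue h" "integral\<^sup>L lebesgue h \<le> 2 * (2 * r) ^ CARD('n)"
proof -
  \<comment> \<open>A cube containing the ball of radius \<open>r / 2 ^ k\<close>, chosen because
    its measure is explicit.\<close>
  define S where "S k = (ccube 0 (2 * (r / 2 ^ k)) :: (real^'n) set)" for k :: nat
  have S_meas: "S k \<in> sets lebesgue" for k by (simp add: S_def ccube_def)
  have S_emeasure: "emeasure lebesgue (S k) \<le> ennreal ((2 * r) ^ CARD('n) * (1/2) ^ k)" for k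
  proof -
    have "emeasure lebesgue (S k) = ennreal (measure lebesgue (S k))"
      using averageable_lmeasurable[OF averageable_ccube[of "2 * (r / 2 ^ k)" 0]] r
      by (intro emeasure_eq_measure2) (simp add: S_def fmeasurable_def)
    also have "measure lebesgue (S k) = (2 * r) ^ CARD('n) * ((1/2) ^ k) ^ CARD('n)"
      using r by (simp add: S_def measure_ccube power_mult_distrib power_divide)
    \<comment> \<open>Keeping a single factor \<open>(1/2) ^ k\<close> leaves a geometric series
      with sum two in every dimension.\<close>
    also have "((1/2::real) ^ k) ^ CARD('n) \<le> ((1/2) ^ k) ^ 1"
      by (intro power_decreasing) (auto simp: Suc_le_eq power_le_one)
    finally show ?thesis using r by (simp add: ennreal_leI mult_left_mono)
  qed
  have count: "ennreal (h y) \<le> (\<Sum>k. indicator (S k) y)" for y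
  proof (cases "norm y < r \<and> y \<noteq> 0")
    case True
    \<comment> \<open>The point lies in \<open>S 0\<close> up to \<open>S q\<close>, that is in
      \<open>q + 1\<close> of the sets, and \<open>q + 1\<close> dominates the binary logarithm,
      hence also the natural one since \<open>ln 2 < 1\<close>.\<close>
    define q where "q = nat \<lfloor>log 2 (r / norm y)\<rfloor>"
    have u: "1 < r / norm y" using True by simp
    have log0: "0 \<le> log 2 (r / norm y)" using u by simp
    have q: "real q \<le> log 2 (r / norm y)" "log 2 (r / norm y) \<le> real (Suc q)"
      unfolding q_def using log0 by linarith+
    have mem: "y \<in> S k" if "k \<le> q" for k
    proof -
      have "2 ^ k \<le> (2::real) ^ q" using that by simp
      also have "\<dots> = 2 powr real q" by (simp add: powr_realpow)
      also have "\<dots> \<le> 2 powr (log 2 (r / norm y))" using q by (intro powr_mono) auto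
      also have "\<dots> = r / norm y" using u by simp
      finally have "norm y \<le> r / 2 ^ k" using True by (simp add: field_simps)
      then show ?thesis
        unfolding S_def mem_ccube using component_le_norm_cart[of y] by (auto intro: order_trans)
    qed
    have "h y = ln (r / norm y)" using u by (simp add: h_def)
    also have "\<dots> = log 2 (r / norm y) * ln 2" by (simp add: log_def)
    also have "\<dots> \<le> log 2 (r / norm y) * 1" using log0 ln_2_less_1 by (intro mult_left_mono) auto
    finally have "h y \<le> real (Suc q)" using q by simp
    then have "ennreal (h y) \<le> ennreal (real (Suc q))" by (rule ennreal_leI)
    also have "\<dots> = (\<Sum>k\<le>q. indicator (S k) y)" using mem by (simp add: ennreal_of_nat_eq_real_of_nat)
    also have "\<dots> \<le> (\<Sum>k. indicator (S k) y)" by (rule sum_le_suminf) auto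
    finally show ?thesis .
  next
    case False
    \<comment> \<open>At the origin this rests on the conventions \<open>r / 0 = 0\<close> and
      \<open>ln 0 = 0\<close>.\<close>
    then have "h y = 0" using r by (cases "y = 0") (auto simp: h_def)
    then show ?thesis by simp
  qed
  have "(\<integral>\<^sup>+y. ennreal (h y) \<partial>lebesgue) \<le> (\<integral>\<^sup>+y. (\<Sum>k. indicator (S k) y) \<partial>lebesgue)"
    by (intro nn_integral_mono count)
  also have "\<dots> = (\<Sum>k. emeasure lebesgue (S k))"
    using S_meas by (subst nn_integral_suminf) auto
  also have "\<dots> \<le> (\<Sum>k. ennreal ((2 * r) ^ CARD('n) * (1/2) ^ k))"
    by (intro suminf_le S_emeasure) auto
  also have "\<dots> = ennreal (2 * (2 * r) ^ CARD('n))"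
  proof -
    have "(\<lambda>k. (2 * r) ^ CARD('n) * (1/2) ^ k) sums ((2 * r) ^ CARD('n) * (1 / (1 - 1/2)))"
      by (intro sums_mult geometric_sums) simp
    then show ?thesis using r by (intro suminf_ennreal_eq) (auto simp: mult.commute)
  qed
  finally have le: "(\<integral>\<^sup>+y. ennreal (h y) \<partial>lebesgue) \<le> ennreal (2 * (2 * r) ^ CARD('n))" .
  have meas: "h \<in> borel_measurable lebesgue"
  proof -
    have "h \<in> borel_measurable borel" unfolding h_def by measurable
    then show ?thesis by (intro measurable_completion) simp
  qed
  show "integrable lebesgue h"
    using le meas by (intro integrableI_nonneg) (auto simp: h_def le_less_trans)
  show "integral\<^sup>L lebesgue h \<le> 2 * (2 * r) ^ CARD('n)"
    using le r by (intro integral_real_bounded) auto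
qed

text \<open>If the cube is near the origin relative to its size, \<open>r\<close> is comparable to
  \<open>l\<close> and the integral over the whole space is of order \<open>l ^ CARD('n)\<close>. If
  it is far away, \<open>norm y\<close> is comparable to \<open>r\<close> on the cube and
  \<open>h\<close> is bounded by \<open>ln 4\<close>.\<close>

lemma average_log_singularity:
  fixes c :: "real^'n"
  assumes l: "0 < l" and r: "r = norm c + l"
  defines "h \<equiv> \<lambda>y::real^'n. max 0 (ln (r / norm y))"
  shows "set_integrable lebesgue (ccube c l) h"
    "average (ccube c l) h \<le> 2 * (2 * (real CARD('n) + 1)) ^ CARD('n)"
proof -
  let ?n = "real CARD('n)"
  have r_pos: "0 < r" using l r by (simp add: add_nonneg_pos)
  note Q = averageable_ccube[OF l, of c]
  have int: "integrable lebesgue h" "integral\<^sup>L lebesgue h \<le> 2 * (2 * r) ^ CARD('n)"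
    using log_singularity[OF r_pos, where 'n='n] by (simp_all add: h_def)
  show h: "set_integrable lebesgue (ccube c l) h"
    using integrable_mult_indicator[OF _ int(1)] Q by (simp add: set_integrable_def averageable_def)
  have n: "1 \<le> ?n" by (simp add: Suc_le_eq)
  show "average (ccube c l) h \<le> 2 * (2 * (?n + 1)) ^ CARD('n)"
  proof (cases "norm c < ?n * l")
    case True
    then have r_le: "r \<le> (?n + 1) * l" using r by (simp add: algebra_simps)
    have "(LINT y:ccube c l|lebesgue. h y) \<le> integral\<^sup>L lebesgue h"
      unfolding set_lebesgue_integral_def
      using h int(1) by (intro integral_mono) (auto simp: set_integrable_def indicator_def h_def)
    also have "\<dots> \<le> 2 * (2 * ((?n + 1) * l)) ^ CARD('n)"
    proof -
      have "(2 * r) ^ CARD('n) \<le> (2 * ((?n + 1) * l)) ^ CARD('n)"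
        using r_le r_pos by (intro power_mono) auto
      then show ?thesis using int(2) by linarith
    qed
    also have "\<dots> = 2 * (2 * (?n + 1)) ^ CARD('n) * l ^ CARD('n)"
      by (simp only: power_mult_distrib mult.assoc)
    finally show ?thesis
      by (simp only: average_def measure_ccube[OF less_imp_le[OF l]] pos_divide_le_eq[OF zero_less_power[OF l]])
  next
    case False
    have "h y \<le> ln 4" if "y \<in> ccube c l" for y
    proof -
      \<comment> \<open>A point of the cube is within \<open>norm c / 2\<close> of \<open>c\<close>,
        hence \<open>norm c \<le> 2 * norm y\<close>; as also \<open>l \<le> norm c\<close>, this
        gives \<open>r \<le> 4 * norm y\<close>.\<close>
      have "norm c \<le> norm (y - c) + norm y" using norm_triangle_ineq4[of y "y - c"] by simp
      then have "norm c \<le> ?n * (l/2) + norm y" using norm_le_ccube[OF that] by linarith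
      then have "norm c \<le> 2 * norm y" using False by (simp add: field_simps)
      moreover have "l \<le> ?n * l" using n l by simp
      ultimately have "r \<le> 4 * norm y" using False r by linarith
      moreover from this have "0 < norm y" using r_pos by linarith
      ultimately have "r / norm y \<le> 4" by (simp add: field_simps)
      then have "ln (r / norm y) \<le> ln 4" using r_pos \<open>0 < norm y\<close> by (intro ln_mono) auto
      then show ?thesis by (simp add: h_def)
    qed
    then have "average (ccube c l) h \<le> average (ccube c l) (\<lambda>_. ln 4)"
      by (intro average_mono_AE h averageable_const Q AE_I2) auto
    also have "\<dots> = ln 4" by (rule averageable_const[OF Q])
    also have "ln 4 \<le> (4 - 1 :: real)" by (rule ln_le_minus_one) simp
    also have "\<dots> \<le> 2 * (2 * (?n + 1)) ^ 1" using n by simp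
    also have "\<dots> \<le> 2 * (2 * (?n + 1)) ^ CARD('n)"
      using n by (intro mult_left_mono power_increasing) (auto simp: Suc_le_eq)
    finally show ?thesis .
  qed
qed

text \<open>The logarithm of the weight average is \<open>ln A - a * ln (norm y)\<close> with
  \<open>A \<le> (?n * t * r) powr a\<close>. The factor \<open>t powr a\<close> gives the
  dimension, and what remains is \<open>a * ln (r / norm y)\<close>, whose averages are bounded
  uniformly over all cubes.\<close>

lemma power_weight_D_upper:
  assumes p: "0 < p" and a: "0 < a"
  shows "(power_weight a :: real^'n \<Rightarrow> complex^'m^'m) \<in> D_upper p a"
proof -
  let ?W = "power_weight a :: real^'n \<Rightarrow> complex^'m^'m"
  let ?n = "real CARD('n)"
  note W = matrix_weight_power_weight[OF a, where 'n='n and 'm='m]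
  define M where "M = 2 * (2 * (?n + 1)) ^ CARD('n)"
  define C where "C = ?n powr a * exp (a * M)"
  have n: "1 \<le> ?n" by (simp add: Suc_le_eq)
  have "set_integrable lebesgue (ccube c l) (\<lambda>y. ln (weight_avg p ?W (ccube c (t * l)) y)) \<and>
    average (ccube c l) (\<lambda>y. ln (weight_avg p ?W (ccube c (t * l)) y)) \<le> ln (C * t powr a)"
    if t: "1 \<le> t" and l: "0 < l" for t l and c :: "real^'n"
  proof -
    define r where "r = norm c + l"
    define h where "h y = max 0 (ln (r / norm y))" for y :: "real^'n"
    define A where "A = average (ccube c (t * l)) (\<lambda>x. norm x powr a)"
    have r: "0 < r" using l by (simp add: r_def add_nonneg_pos)
    have Q: "averageable (ccube c l)" and E: "averageable (ccube c (t * l))"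
      using t l by (simp_all add: averageable_ccube)
    have A_pos: "0 < A" unfolding A_def using t l by (intro average_norm_powr_pos a) simp
    \<comment> \<open>Every point of the dilated cube has norm at most
      \<open>?n * t * l / 2 + norm c\<close>, which is at most \<open>?n * t * r\<close>.\<close>
    have "A \<le> average (ccube c (t * l)) (\<lambda>_. (?n * t * r) powr a)"
      unfolding A_def
    proof (intro average_mono_AE norm_powr_integrable a averageable_const E AE_I2 impI)
      fix x assume "x \<in> ccube c (t * l)"
      then have "norm (x - c) \<le> ?n * (t * l / 2)" by (rule norm_le_ccube)
      moreover have "norm x \<le> norm (x - c) + norm c" using norm_triangle_ineq[of "x - c" c] by simp
      moreover have "norm c \<le> ?n * t * norm c" using n t mult_mono[of 1 ?n 1 t] by (intro mult_le_cancel_right1[THEN iffD2]) auto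
      moreover have "0 \<le> ?n * (t * l / 2)" using t l by simp
      ultimately have "norm x \<le> ?n * t * r" by (simp add: r_def algebra_simps)
      then show "norm x powr a \<le> (?n * t * r) powr a" using a by (intro powr_mono2) auto
    qed
    also have "\<dots> = (?n * t * r) powr a" by (rule averageable_const[OF E])
    finally have A_le: "A \<le> (?n * t * r) powr a" .
    have h: "set_integrable lebesgue (ccube c l) h" "average (ccube c l) h \<le> M"
      using average_log_singularity[OF l refl, of c] by (simp_all add: h_def[abs_def] r_def M_def)
    have int: "set_integrable lebesgue (ccube c l) (\<lambda>y. a * ln (?n * t) + a * h y)"
      by (intro set_integral_add averageable_const Q set_integrable_mult_right h)
    have le: "AE y in lebesgue. y \<in> ccube c l \<longrightarrow> ln (weight_avg p ?W (ccube c (t * l)) y) \<le> a * ln (?n * t) + a * h y"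
      using AE_nonzero
    proof eventually_elim
      case (elim y)
      have "ln (weight_avg p ?W (ccube c (t * l)) y) = ln A - a * ln (norm y)"
        unfolding weight_avg_power_weight[OF p] A_def[symmetric]
        using elim A_pos by (simp add: ln_mult ln_powr)
      also have "ln A \<le> a * ln (?n * t * r)"
        using A_le A_pos n t r by (metis ln_mono ln_powr)
      also have "a * ln (?n * t * r) - a * ln (norm y) = a * ln (?n * t) + a * ln (r / norm y)"
        using elim n t r by (simp add: ln_mult ln_div algebra_simps)
      also have "\<dots> \<le> a * ln (?n * t) + a * h y" using a by (simp add: h_def)
      finally show ?case by simp
    qed
    have int': "set_integrable lebesgue (ccube c l) (\<lambda>y. ln (weight_avg p ?W (ccube c (t * l)) y))"
      by (rule ln_weight_avg_integrable[OF W p Q E int le])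
    have "average (ccube c l) (\<lambda>y. ln (weight_avg p ?W (ccube c (t * l)) y)) \<le> a * ln (?n * t) + a * average (ccube c l) h"
      using average_mono_AE[OF int' int le] averageable_const[OF Q]
      by (simp add: average_add set_integrable_mult_right h average_cmult)
    also have "\<dots> \<le> a * ln (?n * t) + a * M" using h(2) a by simp
    also have "\<dots> = ln (C * t powr a)"
      using n t by (simp add: C_def ln_mult ln_powr algebra_simps)
    finally show ?thesis using int' by simp
  qed
  moreover have "0 < C" using n by (simp add: C_def)
  ultimately show ?thesis unfolding D_upper_iff[OF W p] by blast
qed

theorem proposition6p4:
  fixes p :: real
  assumes "0 < p"
  shows "(\<forall>d<0. (D_upper p d :: (real^'n \<Rightarrow> complex^'m^'m) set) = {}) \<and>
    (\<Union>d\<in>{0..}. D_upper p d) = (Ap_inf p :: (real^'n \<Rightarrow> complex^'m^'m) set) \<and>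
    (\<forall>d1 d2. 0 \<le> d1 \<and> d1 < d2 \<longrightarrow>
       (D_upper p d1 :: (real^'n \<Rightarrow> complex^'m^'m) set) \<subset> D_upper p d2) \<and>
    (p \<le> 1 \<longrightarrow> (Ap p :: (real^'n \<Rightarrow> complex^'m^'m) set) \<subseteq> D_upper p 0)"
proof -
  have D: "matrix_weight W" if "W \<in> D_upper p d" for W :: "real^'n \<Rightarrow> complex^'m^'m" and d
    using that by (simp add: D_upper_def)
  have A: "matrix_weight W" if "W \<in> Ap_inf p" for W :: "real^'n \<Rightarrow> complex^'m^'m"
    using that by (simp add: Ap_inf_def)
  have A': "matrix_weight W" if "W \<in> Ap p" for W :: "real^'n \<Rightarrow> complex^'m^'m"
    using that by (simp add: Ap_def)
  show ?thesis
  proof (intro conjI allI impI)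
    fix d :: real assume "d < 0"
    then show "(D_upper p d :: (real^'n \<Rightarrow> complex^'m^'m) set) = {}"
      using D_upper_neg[OF D assms] by blast
  next
    show "(\<Union>d\<in>{0..}. D_upper p d) = (Ap_inf p :: (real^'n \<Rightarrow> complex^'m^'m) set)"
    proof (intro equalityI subsetI)
      fix W :: "real^'n \<Rightarrow> complex^'m^'m" assume "W \<in> (\<Union>d\<in>{0..}. D_upper p d)"
      then show "W \<in> Ap_inf p" using D_upper_subset_Ap_inf[OF D assms] by blast
    next
      fix W :: "real^'n \<Rightarrow> complex^'m^'m" assume "W \<in> Ap_inf p"
      then show "W \<in> (\<Union>d\<in>{0..}. D_upper p d)" using Ap_inf_subset_D_upper[OF A assms] by auto
    qed
  next
    fix d1 d2 :: real assume d: "0 \<le> d1 \<and> d1 < d2"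
    \<comment> \<open>The exponent \<open>d2\<close> is positive because \<open>d1\<close> is
      nonnegative, so this weight belongs to the larger class and, as \<open>d1 < d2\<close>, not to
      the smaller one.\<close>
    let ?W = "power_weight d2 :: real^'n \<Rightarrow> complex^'m^'m"
    have "?W \<in> D_upper p d2" "?W \<notin> D_upper p d1"
      using d assms by (auto intro: power_weight_D_upper simp: power_weight_not_D_upper)
    moreover have "(D_upper p d1 :: (real^'n \<Rightarrow> complex^'m^'m) set) \<subseteq> D_upper p d2"
      using D_upper_mono[OF D assms] less_imp_le[OF conjunct2[OF d]] by blast
    ultimately show "(D_upper p d1 :: (real^'n \<Rightarrow> complex^'m^'m) set) \<subset> D_upper p d2" by blast
  next
    show "(Ap p :: (real^'n \<Rightarrow> complex^'m^'m) set) \<subseteq> D_upper p 0"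
      using Ap_subset_D_upper_0[OF A' assms] by blast
  qed
qed

end
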